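(* Let $\mathcal K$ be a relational Fraïssé class which is Ramsey. If $G_\mathcal K$ is amenable, then $G_\mathcal K$ is uniquely ergodic, and the unique $G_\mathcal K$-invariant Borel probability measure on $M(G_\mathcal K)$ is concentrated on (i.e. gives measure $1$ to) an orbit which is dense $G_\delta$ in $M(G_\mathcal K)$; moreover this dense $G_\delta$ orbit is unique.
   Context: Structures are over a countable relational language $L$. A class $\mathcal K$ of finite $L$-structures is a Fraïssé class if it is hereditary, has joint embedding, has amalgamation, and contains arbitrarily large finite structures; $\mathrm{Flim}(\mathcal K)$ is its Fraïssé limit (the unique countable ultrahomogeneous structure with age $\mathcal K$), and $G_\mathcal K=\mathrm{Aut}(\mathrm{Flim}(\mathcal K))$ with the pointwise convergence topology. $\binom{B}{A}$ is the set of substructures of $B$ isomorphic to $A$; $C\to(B)^A_{k,d}$ means every colouring $\chi:\binom{C}{A}\to\{0,\dots,k-1\}$ admits $B'\in\binom{C}{B}$ with $|\chi(\binom{B'}{A})|\le d$; $\mathcal K$ is Ramsey if for all $A,B\in\mathcal K$ and $k\ge2$ there is $C\in\mathcal K$ with $C\to(B)^A_{k,1}$. $M(G)$ denotes the universal minimal $G$-flow (a $G$-flow is a continuous action on a compact Hausdorff space). $G$ is amenable if there exists a $G$-invariant Borel probability measure on $M(G)$, and uniquely ergodic if there is exactly one. *)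

theory Defs
  imports "HOL-Probability.Probability"
begin

text \<open>A relational language is given by a (countable) type 'l of relation symbols
together with an arity function ar. An L-structure with universe in type 'a is a pair
(A, R): A is the universe, R r xs says that the tuple xs (a list of length ar r) is in
the interpretation of the symbol r.\<close>

type_synonym ('l,'a) struc = "'a set \<times> ('l \<Rightarrow> 'a list \<Rightarrow> bool)"

definition wf_struc :: "('l \<Rightarrow> nat) \<Rightarrow> ('l,'a) struc \<Rightarrow> bool" where
  "wf_struc ar S \<longleftrightarrow> (\<forall>r xs. snd S r xs \<longrightarrow> length xs = ar r \<and> set xs \<subseteq> fst S)"

definition embedding :: "('l,'a) struc \<Rightarrow> ('l,'b) struc \<Rightarrow> ('a \<Rightarrow> 'b) \<Rightarrow> bool" where
  "embedding S T f \<longleftrightarrow> inj_on f (fst S) \<and> f ` fst S \<subseteq> fst T \<and>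
     (\<forall>r xs. set xs \<subseteq> fst S \<longrightarrow> (snd S r xs \<longleftrightarrow> snd T r (map f xs)))"

definition embeds :: "('l,'a) struc \<Rightarrow> ('l,'b) struc \<Rightarrow> bool" where
  "embeds S T \<longleftrightarrow> (\<exists>f. embedding S T f)"

definition isomorphism :: "('l,'a) struc \<Rightarrow> ('l,'b) struc \<Rightarrow> ('a \<Rightarrow> 'b) \<Rightarrow> bool" where
  "isomorphism S T f \<longleftrightarrow> embedding S T f \<and> f ` fst S = fst T"

definition isomorphic :: "('l,'a) struc \<Rightarrow> ('l,'b) struc \<Rightarrow> bool" where
  "isomorphic S T \<longleftrightarrow> (\<exists>f. isomorphism S T f)"

definition substr :: "('l,'a) struc \<Rightarrow> 'a set \<Rightarrow> ('l,'a) struc" where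
  "substr S B = (B, \<lambda>r xs. snd S r xs \<and> set xs \<subseteq> B)"

text \<open>A class of finite L-structures, represented by all its members whose universe
is a (finite) subset of nat; it is closed under isomorphism.\<close>

definition finite_struc_class :: "('l \<Rightarrow> nat) \<Rightarrow> ('l,nat) struc set \<Rightarrow> bool" where
  "finite_struc_class ar K \<longleftrightarrow>
     (\<forall>A\<in>K. wf_struc ar A \<and> finite (fst A)) \<and>
     (\<forall>A B. A \<in> K \<and> wf_struc ar B \<and> isomorphic A B \<longrightarrow> B \<in> K)"

definition hereditary :: "('l \<Rightarrow> nat) \<Rightarrow> ('l,nat) struc set \<Rightarrow> bool" where
  "hereditary ar K \<longleftrightarrow> (\<forall>A B. B \<in> K \<and> wf_struc ar A \<and> finite (fst A) \<and> embeds A B \<longrightarrow> A \<in> K)"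

definition joint_embedding :: "('l,nat) struc set \<Rightarrow> bool" where
  "joint_embedding K \<longleftrightarrow> (\<forall>A\<in>K. \<forall>B\<in>K. \<exists>C\<in>K. embeds A C \<and> embeds B C)"

definition amalgamation :: "('l,nat) struc set \<Rightarrow> bool" where
  "amalgamation K \<longleftrightarrow> (\<forall>A\<in>K. \<forall>B\<in>K. \<forall>C\<in>K. \<forall>f g. embedding A B f \<and> embedding A C g \<longrightarrow>
      (\<exists>D\<in>K. \<exists>f' g'. embedding B D f' \<and> embedding C D g' \<and>
         (\<forall>a\<in>fst A. f' (f a) = g' (g a))))"

definition arbitrarily_large :: "('l,nat) struc set \<Rightarrow> bool" where
  "arbitrarily_large K \<longleftrightarrow> (\<forall>n. \<exists>A\<in>K. card (fst A) \<ge> n)"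

definition fraisse_class :: "('l \<Rightarrow> nat) \<Rightarrow> ('l,nat) struc set \<Rightarrow> bool" where
  "fraisse_class ar K \<longleftrightarrow> finite_struc_class ar K \<and> hereditary ar K \<and> joint_embedding K \<and>
     amalgamation K \<and> arbitrarily_large K"

definition copies :: "('l,'a) struc \<Rightarrow> ('l,'b) struc \<Rightarrow> 'a set set" where
  "copies C A = {S. S \<subseteq> fst C \<and> isomorphic (substr C S) A}"

definition arrows :: "('l,'a) struc \<Rightarrow> ('l,'b) struc \<Rightarrow> ('l,'c) struc \<Rightarrow> nat \<Rightarrow> nat \<Rightarrow> bool" where
  "arrows C B A k d \<longleftrightarrow> (\<forall>(col :: 'a set \<Rightarrow> nat). col ` copies C A \<subseteq> {..<k} \<longrightarrow>
      (\<exists>B'\<in>copies C B. card (col ` copies (substr C B') A) \<le> d))"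

definition ramsey_class :: "('l,nat) struc set \<Rightarrow> bool" where
  "ramsey_class K \<longleftrightarrow> (\<forall>A\<in>K. \<forall>B\<in>K. \<forall>k\<ge>2. \<exists>C\<in>K. arrows C B A k 1)"

definition age :: "('l \<Rightarrow> nat) \<Rightarrow> ('l,'a) struc \<Rightarrow> ('l,nat) struc set" where
  "age ar F = {A. wf_struc ar A \<and> finite (fst A) \<and> embeds A F}"

definition ultrahomogeneous :: "('l,'a) struc \<Rightarrow> bool" where
  "ultrahomogeneous F \<longleftrightarrow> (\<forall>A B f. A \<subseteq> fst F \<and> B \<subseteq> fst F \<and> finite A \<and> finite B \<and>
      isomorphism (substr F A) (substr F B) f \<longrightarrow>
      (\<exists>g. isomorphism F F g \<and> (\<forall>a\<in>A. g a = f a)))"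

text \<open>The Fraisse limit is countable (and infinite, as K has arbitrarily large members),
so we take it with universe nat.\<close>
definition is_fraisse_limit :: "('l \<Rightarrow> nat) \<Rightarrow> ('l,nat) struc set \<Rightarrow> ('l \<Rightarrow> nat list \<Rightarrow> bool) \<Rightarrow> bool" where
  "is_fraisse_limit ar K R \<longleftrightarrow> wf_struc ar (UNIV, R) \<and> ultrahomogeneous (UNIV, R) \<and>
      age ar (UNIV, R) = K"

definition Aut :: "('l,nat) struc \<Rightarrow> (nat \<Rightarrow> nat) set" where
  "Aut F = {g. isomorphism F F g}"

definition ptwise_top :: "(nat \<Rightarrow> nat) set \<Rightarrow> (nat \<Rightarrow> nat) topology" where
  "ptwise_top G = subtopology (product_topology (\<lambda>_. discrete_topology (UNIV::nat set)) UNIV) G"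

definition G_flow :: "(nat \<Rightarrow> nat) set \<Rightarrow> 'x topology \<Rightarrow> ((nat \<Rightarrow> nat) \<Rightarrow> 'x \<Rightarrow> 'x) \<Rightarrow> bool" where
  "G_flow G X act \<longleftrightarrow> compact_space X \<and> Hausdorff_space X \<and>
     continuous_map (prod_topology (ptwise_top G) X) X (\<lambda>(g,x). act g x) \<and>
     (\<forall>x\<in>topspace X. act id x = x) \<and>
     (\<forall>g\<in>G. \<forall>h\<in>G. \<forall>x\<in>topspace X. act (g \<circ> h) x = act g (act h x))"

definition minimal_flow :: "(nat \<Rightarrow> nat) set \<Rightarrow> 'x topology \<Rightarrow> ((nat \<Rightarrow> nat) \<Rightarrow> 'x \<Rightarrow> 'x) \<Rightarrow> bool" where
  "minimal_flow G X act \<longleftrightarrow> G_flow G X act \<and> topspace X \<noteq> {} \<and>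
     (\<forall>C. closedin X C \<and> (\<forall>g\<in>G. \<forall>x\<in>C. act g x \<in> C) \<longrightarrow> C = {} \<or> C = topspace X)"

definition flow_factor :: "(nat \<Rightarrow> nat) set \<Rightarrow> 'x topology \<Rightarrow> ((nat \<Rightarrow> nat) \<Rightarrow> 'x \<Rightarrow> 'x) \<Rightarrow>
     'y topology \<Rightarrow> ((nat \<Rightarrow> nat) \<Rightarrow> 'y \<Rightarrow> 'y) \<Rightarrow> ('x \<Rightarrow> 'y) \<Rightarrow> bool" where
  "flow_factor G X act Y act' \<pi> \<longleftrightarrow> continuous_map X Y \<pi> \<and> \<pi> ` topspace X = topspace Y \<and>
     (\<forall>g\<in>G. \<forall>x\<in>topspace X. \<pi> (act g x) = act' g (\<pi> x))"

text \<open>Universal minimal flow: a minimal flow having every minimal flow as a factor.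
Flows Y range over carriers in the type (nat => nat) set set, which is large enough to
contain (a copy of) every minimal G-flow, since every minimal G-flow is a continuous image
of the Stone-Cech compactification of G as a discrete set, i.e. of a set of ultrafilters on
G, and G is a set of functions nat => nat.\<close>
definition universal_minimal_flow :: "(nat \<Rightarrow> nat) set \<Rightarrow> 'x topology \<Rightarrow> ((nat \<Rightarrow> nat) \<Rightarrow> 'x \<Rightarrow> 'x) \<Rightarrow> bool" where
  "universal_minimal_flow G X act \<longleftrightarrow> minimal_flow G X act \<and>
     (\<forall>(Y :: (nat \<Rightarrow> nat) set set topology) act'. minimal_flow G Y act' \<longrightarrow>
        (\<exists>\<pi>. flow_factor G X act Y act' \<pi>))"

definition borel_of :: "'x topology \<Rightarrow> 'x measure" where
  "borel_of X = sigma (topspace X) {U. openin X U}"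

definition invariant_borel_prob :: "(nat \<Rightarrow> nat) set \<Rightarrow> 'x topology \<Rightarrow> ((nat \<Rightarrow> nat) \<Rightarrow> 'x \<Rightarrow> 'x) \<Rightarrow>
     'x measure \<Rightarrow> bool" where
  "invariant_borel_prob G X act \<mu> \<longleftrightarrow> sets \<mu> = sets (borel_of X) \<and> prob_space \<mu> \<and>
     (\<forall>g\<in>G. \<forall>A\<in>sets \<mu>. emeasure \<mu> {x\<in>topspace X. act g x \<in> A} = emeasure \<mu> A)"

definition flow_orbit :: "(nat \<Rightarrow> nat) set \<Rightarrow> ((nat \<Rightarrow> nat) \<Rightarrow> 'x \<Rightarrow> 'x) \<Rightarrow> 'x \<Rightarrow> 'x set" where
  "flow_orbit G act x = (\<lambda>g. act g x) ` G"

definition dense_gdelta_orbit :: "(nat \<Rightarrow> nat) set \<Rightarrow> 'x topology \<Rightarrow> ((nat \<Rightarrow> nat) \<Rightarrow> 'x \<Rightarrow> 'x) \<Rightarrow>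
     'x set \<Rightarrow> bool" where
  "dense_gdelta_orbit G X act Orb \<longleftrightarrow> (\<exists>x\<in>topspace X. Orb = flow_orbit G act x) \<and>
     X closure_of Orb = topspace X \<and> gdelta_in X Orb"

end

theory Submission
  imports Defs "HOL-Library.Ramsey"
begin

text \<open>
  Universality maps \<open>X\<close> onto a minimal subflow of the space of linear orders on the Fraisse limit, so every
  point of \<open>X\<close> carries a linear order. The Ramsey property for copies says that the setwise stabiliser
  of a finite set \<open>A\<close> acts topologically transitively on \<open>X\<close>. Hence any two orders that occur on
  \<open>A\<close> are conjugate under automorphisms of \<open>A\<close>; it also follows that a point of \<open>X\<close> is determined by
  its order. An invariant measure is therefore uniform on the orders of \<open>A\<close>, which gives uniqueness.

  For the generic orbit one has to show that almost every order has the one-point extension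
  property. Call two points swappable if both of their orders occur; this is an equivalence relation,
  and three mutually swappable points carry either all six orders with probability 1/6 or only
  two mutually reverse ones. In the first case the infinite Ramsey theorem produces, for each \<open>N\<close>, a set of \<open>N\<close>
  realisations of the type to be extended that are exchangeable with the right end point of the
  interval in question, so that the interval misses them with probability at most \<open>1 / (N + 1)\<close>. In all other
  cases the exceptional set is open and empty by transitivity.
\<close>

subsection \<open>Ramsey property and minimal flows\<close>

text \<open>The Ramsey property colours copies, not embeddings, so it controls only setwise
  stabilisers, whereas the neighbourhoods of the identity in the group are given by pointwise ones.
  Linear orders close this gap: a finite linear order is rigid, so an element that preserves a
  finite set together with its order fixes the set pointwise. This is why an order on the points of
  \<open>X\<close> has to be found before anything else. The obstacle for the generic orbit is that
  a one-point extension over \<open>A\<close> can have infinitely many realisations. The points at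
  which all of them miss the prescribed interval then form a closed set that need not be open, and
  transitivity only rules out open sets; its smallness has to come from the measure. A single triple
  yields no more than the constant 1/6, and only exchangeability among arbitrarily many candidates
  drives the probability to 0. The dichotomy for triples is a matter of measure as well: an order
  that occurs has positive probability, and linear relations between these probabilities force
  reverse orders to occur together.\<close>

lemma Aut_iff:
  "g \<in> Aut (UNIV, R) \<longleftrightarrow> bij g \<and> (\<forall>r xs. R r (map g xs) \<longleftrightarrow> R r xs)"
  by (auto simp: Aut_def isomorphism_def embedding_def bij_def)

text \<open>What the dynamics sees of the Fraisse limit is a closed permutation group. By
  ultrahomogeneity the copies of a finite set \<open>A\<close> are exactly its translates, so
  structures disappear from the Ramsey property. The two colours will record whether a point lies in
  an open set.\<close>

locale ramsey_group =
  fixes G :: "(nat \<Rightarrow> nat) set"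
  assumes bij_G: "g \<in> G \<Longrightarrow> bij g"
    and id_G: "id \<in> G"
    and comp_G: "g \<in> G \<Longrightarrow> h \<in> G \<Longrightarrow> g \<circ> h \<in> G"
    and inv_G: "g \<in> G \<Longrightarrow> inv g \<in> G"
    and closed_G: "bij g \<Longrightarrow> (\<And>A. finite A \<Longrightarrow> \<exists>h\<in>G. \<forall>a\<in>A. h a = g a) \<Longrightarrow> g \<in> G"
    and ramsey: "\<And>A B (col :: nat set \<Rightarrow> bool). finite A \<Longrightarrow> finite B \<Longrightarrow>
      \<exists>h\<in>G. \<exists>c. \<forall>g\<in>G. g ` A \<subseteq> h ` B \<longrightarrow> col (g ` A) = c"

text \<open>The colouring is pulled back along an embedding \<open>f\<close> of \<open>C\<close>
  into the limit. Ultrahomogeneity extends the isomorphism from \<open>B\<close> onto the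
  \<open>f\<close>-image of the homogeneous copy \<open>B'\<close> to an automorphism
  \<open>h\<close>. Every translate of \<open>A\<close> inside the \<open>h\<close>-image of
  \<open>B\<close> then comes from a copy of \<open>A\<close> inside \<open>B'\<close>.\<close>

lemma Aut_ramsey:
  fixes col :: "nat set \<Rightarrow> bool"
  assumes K: "ramsey_class K" and F: "is_fraisse_limit ar K R"
    and fin: "finite A" "finite B"
  shows "\<exists>h\<in>Aut (UNIV, R). \<exists>c. \<forall>g\<in>Aut (UNIV, R). g ` A \<subseteq> h ` B \<longrightarrow> col (g ` A) = c"
proof -
  let ?F = "(UNIV, R)"
  have wf: "wf_struc ar ?F" and uh: "ultrahomogeneous ?F" and age: "age ar ?F = K"
    using F by (auto simp: is_fraisse_limit_def)
  have sub: "substr ?F D \<in> K" if "finite D" for D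
  proof -
    have "embedding (substr ?F D) ?F id"
      by (auto simp: embedding_def substr_def)
    moreover have "wf_struc ar (substr ?F D)"
      using wf by (auto simp: wf_struc_def substr_def)
    ultimately show ?thesis
      using that by (auto simp: age[symmetric] age_def embeds_def substr_def)
  qed
  obtain C where C: "C \<in> K" and arr: "arrows C (substr ?F B) (substr ?F A) 2 1"
    using K sub fin unfolding ramsey_class_def by (meson order_refl)
  obtain f where f: "embedding C ?F f"
    using C by (auto simp: age[symmetric] age_def embeds_def)
  define cc where "cc = (\<lambda>S. if col (f ` S) then (1::nat) else 0)"
  have "cc ` copies C (substr ?F A) \<subseteq> {..<2}"
    by (auto simp: cc_def)
  then obtain B' where B': "B' \<in> copies C (substr ?F B)"
    and mono: "card (cc ` copies (substr C B') (substr ?F A)) \<le> 1"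
    using arr unfolding arrows_def by blast
  have B'C: "B' \<subseteq> fst C" using B' by (simp add: copies_def)
  obtain \<phi> where \<phi>: "isomorphism (substr C B') (substr ?F B) \<phi>"
    using B' by (auto simp: copies_def isomorphic_def)
  have inj\<phi>: "inj_on \<phi> B'" and im\<phi>: "\<phi> ` B' = B"
    and rel\<phi>: "\<And>r xs. set xs \<subseteq> B' \<Longrightarrow> snd C r xs \<longleftrightarrow> R r (map \<phi> xs)"
    using \<phi> by (auto simp: isomorphism_def embedding_def substr_def)
  have injf: "inj_on f (fst C)" and relf: "\<And>r xs. set xs \<subseteq> fst C \<Longrightarrow> snd C r xs \<longleftrightarrow> R r (map f xs)"
    using f by (auto simp: embedding_def)
  define \<psi> where "\<psi> = inv_into B' \<phi>"
  have \<psi>B: "\<psi> ` B = B'" using inj\<phi> im\<phi> by (auto simp: \<psi>_def)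
  have inj\<psi>: "inj_on \<psi> B" using im\<phi> by (auto simp: \<psi>_def intro: inj_on_inv_into)
  have \<phi>\<psi>: "\<phi> (\<psi> b) = b" if "b \<in> B" for b
    using that im\<phi> by (simp add: \<psi>_def f_inv_into_f)
  have "isomorphism (substr ?F B) (substr ?F (f ` B')) (f \<circ> \<psi>)"
  proof -
    have "R r xs \<longleftrightarrow> R r (map (f \<circ> \<psi>) xs)" if "set xs \<subseteq> B" for r xs
    proof -
      have s: "set (map \<psi> xs) \<subseteq> B'" using that \<psi>B by auto
      have "map \<phi> (map \<psi> xs) = xs" using that \<phi>\<psi> by (auto intro!: map_idI)
      then show ?thesis
        using rel\<phi>[OF s] relf[of "map \<psi> xs" r] s B'C by auto
    qed
    moreover have "inj_on (f \<circ> \<psi>) B"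
      using inj\<psi> \<psi>B injf B'C by (auto intro: comp_inj_on inj_on_subset)
    ultimately show ?thesis
      using \<psi>B by (auto simp: isomorphism_def embedding_def substr_def image_comp[symmetric])
  qed
  then obtain h where h: "isomorphism ?F ?F h" "\<forall>b\<in>B. h b = (f \<circ> \<psi>) b"
    using uh fin B'C C \<psi>B unfolding ultrahomogeneous_def
    by (metis finite_imageI fst_conv subset_UNIV)
  have hB: "h ` B = f ` B'" using h(2) \<psi>B by (auto simp: image_iff)
  have key: "\<exists>S\<in>copies (substr C B') (substr ?F A). f ` S = g ` A"
    if g: "g \<in> Aut ?F" and gA: "g ` A \<subseteq> h ` B" for g
  proof -
    define S where "S = {s\<in>B'. f s \<in> g ` A}"
    have fS: "f ` S = g ` A" using gA hB by (force simp: S_def)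
    have bg: "bij g" and Rg: "\<And>r xs. R r (map g xs) \<longleftrightarrow> R r xs" using g by (auto simp: Aut_iff)
    have SB: "S \<subseteq> B'" by (auto simp: S_def)
    then have SC: "S \<subseteq> fst C" using B'C by blast
    have im: "(inv g \<circ> f) ` S = A"
      using image_comp[of "inv g" f S] fS bg by (simp add: bij_is_inj image_inv_f_f)
    have "inj_on (inv g \<circ> f) S"
      using injf SC bij_imp_bij_inv[OF bg]
      by (auto intro!: comp_inj_on intro: inj_on_subset simp: bij_def)
    moreover have "snd C r xs \<longleftrightarrow> R r (map (inv g \<circ> f) xs)" if "set xs \<subseteq> S" for r xs
    proof -
      have "map g (map (inv g \<circ> f) xs) = map f xs"
        using bg by (simp add: bij_is_surj surj_f_inv_f)
      then show ?thesis
        using relf[of xs r] Rg[of r "map (inv g \<circ> f) xs"] that SC by (simp del: map_map)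
    qed
    ultimately have "isomorphism (substr (substr C B') S) (substr ?F A) (inv g \<circ> f)"
      using im SB by (auto simp: isomorphism_def embedding_def substr_def)
    then have "S \<in> copies (substr C B') (substr ?F A)"
      by (auto simp: copies_def isomorphic_def substr_def S_def)
    then show ?thesis using fS by blast
  qed
  have fincc: "finite (cc ` copies (substr C B') (substr ?F A))"
    by (rule finite_subset[of _ "{0,1}"]) (auto simp: cc_def)
  have "col (g ` A) = col (g' ` A)"
    if gg: "g \<in> Aut ?F" "g ` A \<subseteq> h ` B" "g' \<in> Aut ?F" "g' ` A \<subseteq> h ` B" for g g'
  proof -
    obtain S where S: "S \<in> copies (substr C B') (substr ?F A)" "f ` S = g ` A"
      using key[OF gg(1,2)] by (elim bexE)
    obtain S' where S': "S' \<in> copies (substr C B') (substr ?F A)" "f ` S' = g' ` A"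
      using key[OF gg(3,4)] by (elim bexE)
    have "\<forall>a\<in>cc ` copies (substr C B') (substr ?F A). \<forall>b\<in>cc ` copies (substr C B') (substr ?F A). a = b"
      using mono by (simp only: card_le_Suc0_iff_eq[OF fincc] One_nat_def)
    then have "cc S = cc S'" using S(1) S'(1) by blast
    then show ?thesis using S(2) S'(2) by (simp add: cc_def split: if_splits)
  qed
  moreover have "h \<in> Aut ?F" using h(1) by (simp add: Aut_def)
  ultimately show ?thesis by metis
qed

lemma ramsey_group_Aut:
  assumes "ramsey_class K" "is_fraisse_limit ar K R"
  shows "ramsey_group (Aut (UNIV, R))"
proof
  show "id \<in> Aut (UNIV, R)" by (simp add: Aut_iff)
  show "bij g" if "g \<in> Aut (UNIV, R)" for g using that by (simp add: Aut_iff)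
  show "g \<circ> h \<in> Aut (UNIV, R)" if "g \<in> Aut (UNIV, R)" "h \<in> Aut (UNIV, R)" for g h
    using that by (auto simp: Aut_iff bij_comp map_map[symmetric] simp del: map_map)
  show "inv g \<in> Aut (UNIV, R)" if g: "g \<in> Aut (UNIV, R)" for g
  proof -
    have "map g (map (inv g) xs) = xs" for xs
      using g by (auto simp: Aut_iff surj_f_inv_f bij_is_surj intro!: map_idI)
    then show ?thesis using g by (metis Aut_iff bij_imp_bij_inv)
  qed
  show "g \<in> Aut (UNIV, R)"
    if "bij g" and a: "\<And>A. finite A \<Longrightarrow> \<exists>h\<in>Aut (UNIV, R). \<forall>a\<in>A. h a = g a" for g
  proof -
    have "R r (map g xs) \<longleftrightarrow> R r xs" for r xs
    proof -
      obtain h where "h \<in> Aut (UNIV, R)" "\<forall>a\<in>set xs. h a = g a" using a[of "set xs"] by auto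
      then show ?thesis by (metis Aut_iff map_cong)
    qed
    then show ?thesis using \<open>bij g\<close> by (simp add: Aut_iff)
  qed
qed (use Aut_ramsey[OF assms] in blast)

section \<open>Pointwise and setwise stabilisers\<close>

context ramsey_group
begin

definition stab :: "nat set \<Rightarrow> (nat \<Rightarrow> nat) set" where
  "stab A = {g\<in>G. \<forall>a\<in>A. g a = a}"

definition setstab :: "nat set \<Rightarrow> (nat \<Rightarrow> nat) set" where
  "setstab A = {g\<in>G. g ` A = A}"

lemma inv_simps:
  assumes "g \<in> G" shows "inv g (g a) = a" "g (inv g a) = a"
  using bij_G[OF assms] by (auto simp: bij_is_inj bij_is_surj surj_f_inv_f)

lemma inv_comp: "g \<in> G \<Longrightarrow> inv g \<circ> g = id" "g \<in> G \<Longrightarrow> g \<circ> inv g = id"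
  by (auto simp: inv_simps)

lemma stab_G: "g \<in> stab A \<Longrightarrow> g \<in> G" by (simp add: stab_def)

lemma setstab_G: "g \<in> setstab A \<Longrightarrow> g \<in> G" by (simp add: setstab_def)

lemma id_stab: "id \<in> stab A" using id_G by (simp add: stab_def)

lemma comp_stab: "g \<in> stab A \<Longrightarrow> h \<in> stab A \<Longrightarrow> g \<circ> h \<in> stab A"
  using comp_G by (simp add: stab_def)

lemma inv_stab: "g \<in> stab A \<Longrightarrow> inv g \<in> stab A"
  using inv_G inv_simps by (simp add: stab_def) metis

lemma id_setstab: "id \<in> setstab A" using id_G by (simp add: setstab_def)

lemma comp_setstab: "g \<in> setstab A \<Longrightarrow> h \<in> setstab A \<Longrightarrow> g \<circ> h \<in> setstab A"
  using comp_G image_comp[of g h A] by (simp add: setstab_def)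

lemma inv_setstab: "g \<in> setstab A \<Longrightarrow> inv g \<in> setstab A"
  using inv_G bij_G by (simp add: setstab_def) (metis bij_is_inj image_inv_f_f)

end

section \<open>Topological transitivity in minimal flows\<close>

lemma topspace_ptwise_top: "topspace (ptwise_top G) = G"
  by (simp add: ptwise_top_def)

lemma G_flow_act_in:
  assumes "G_flow G X act" "g \<in> G" "x \<in> topspace X" shows "act g x \<in> topspace X"
proof -
  have "(\<lambda>(g,x). act g x) \<in> topspace (prod_topology (ptwise_top G) X) \<rightarrow> topspace X"
    using assms(1) by (simp add: G_flow_def continuous_map_def)
  then show ?thesis
    using assms by (auto simp: topspace_ptwise_top dest: funcset_mem[of _ _ _ "(g, x)"])
qed

locale ramsey_flow = ramsey_group G for G +
  fixes X :: "'x topology" and act :: "(nat \<Rightarrow> nat) \<Rightarrow> 'x \<Rightarrow> 'x"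
  assumes minimal: "minimal_flow G X act"
begin

lemma flow: "G_flow G X act" and nonempty: "topspace X \<noteq> {}"
  using minimal by (auto simp: minimal_flow_def)

lemma act_in: "g \<in> G \<Longrightarrow> x \<in> topspace X \<Longrightarrow> act g x \<in> topspace X"
  using G_flow_act_in[OF flow] .

lemma act_id: "x \<in> topspace X \<Longrightarrow> act id x = x"
  using flow by (simp add: G_flow_def)

lemma act_comp: "g \<in> G \<Longrightarrow> h \<in> G \<Longrightarrow> x \<in> topspace X \<Longrightarrow> act (g \<circ> h) x = act g (act h x)"
  using flow by (simp add: G_flow_def)

lemma act_inv: "g \<in> G \<Longrightarrow> x \<in> topspace X \<Longrightarrow> act (inv g) (act g x) = x"
  "g \<in> G \<Longrightarrow> x \<in> topspace X \<Longrightarrow> act g (act (inv g) x) = x"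
  using act_comp[of "inv g" g x] act_comp[of g "inv g" x] act_id inv_comp inv_G by auto

lemma open_act_vimage:
  assumes "g \<in> G" "openin X U" shows "openin X {x\<in>topspace X. act g x \<in> U}"
proof -
  have "continuous_map X (prod_topology (ptwise_top G) X) (\<lambda>x. (g, x))"
    using assms topspace_ptwise_top by (auto intro!: continuous_map_pairedI)
  moreover have "continuous_map (prod_topology (ptwise_top G) X) X (\<lambda>(g,x). act g x)"
    using flow by (simp add: G_flow_def)
  ultimately have "continuous_map X X ((\<lambda>(g,x). act g x) \<circ> (\<lambda>x. (g, x)))"
    by (rule continuous_map_compose)
  then show ?thesis using assms by (auto simp: continuous_map_def)
qed

text \<open>Joint continuity at \<open>(id, x)\<close>: a basic neighbourhood of \<open>id\<close>
  constrains finitely many coordinates, and the stabiliser of these is contained in it.\<close>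

lemma open_act_near_id:
  assumes U: "openin X U" and x: "x \<in> U"
  shows "\<exists>A W. finite A \<and> openin X W \<and> x \<in> W \<and> (\<forall>g\<in>stab A. \<forall>w\<in>W. act g w \<in> U)"
proof -
  have xX: "x \<in> topspace X" using U x openin_subset by blast
  have "continuous_map (prod_topology (ptwise_top G) X) X (\<lambda>(g,x). act g x)"
    using flow by (simp add: G_flow_def)
  then have "openin (prod_topology (ptwise_top G) X)
      {p \<in> topspace (prod_topology (ptwise_top G) X). (\<lambda>(g,x). act g x) p \<in> U}"
    using U by (simp add: continuous_map_def)
  moreover have "(id, x) \<in> {p \<in> topspace (prod_topology (ptwise_top G) X). (\<lambda>(g,x). act g x) p \<in> U}"
    using x xX act_id id_G topspace_ptwise_top by simp
  ultimately obtain V W where V: "openin (ptwise_top G) V" "id \<in> V" and W: "openin X W" "x \<in> W"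
    and VW: "V \<times> W \<subseteq> {p \<in> topspace (prod_topology (ptwise_top G) X). (\<lambda>(g,x). act g x) p \<in> U}"
    unfolding openin_prod_topology_alt by blast
  obtain V' where V': "openin (product_topology (\<lambda>_. discrete_topology (UNIV::nat set)) UNIV) V'" "V = V' \<inter> G"
    using V(1) by (auto simp: ptwise_top_def openin_subtopology)
  then obtain Q where Q: "finite {i. Q i \<noteq> (UNIV::nat set)}" "id \<in> Pi\<^sub>E UNIV Q" "Pi\<^sub>E UNIV Q \<subseteq> V'"
    using V(2) by (force simp: openin_product_topology_alt)
  have "act g w \<in> U" if g: "g \<in> stab {i. Q i \<noteq> UNIV}" and w: "w \<in> W" for g w
  proof -
    have "g i \<in> Q i" for i
    proof (cases "Q i = UNIV")
      case False
      then show ?thesis using g Q(2) by (auto simp: stab_def PiE_def)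
    qed simp
    then have "g \<in> V" using Q(3) V'(2) g stab_G by auto
    then show ?thesis using VW w by auto
  qed
  then show ?thesis using Q(1) W by blast
qed

text \<open>The points that no group element moves into \<open>U\<close> form a closed invariant
  proper subset, which is empty by minimality; compactness then selects finitely many
  elements.\<close>

lemma finite_translates_cover:
  assumes U: "openin X U" and ne: "U \<noteq> {}"
  shows "\<exists>F. finite F \<and> F \<subseteq> G \<and> (\<forall>x\<in>topspace X. \<exists>g\<in>F. act g x \<in> U)"
proof -
  define V where "V g = {x\<in>topspace X. act g x \<in> U}" for g
  have opV: "openin X (V g)" if "g \<in> G" for g
    using open_act_vimage[OF that U] by (simp add: V_def)
  let ?C = "topspace X - (\<Union>g\<in>G. V g)"
  have "closedin X ?C" using opV by (auto intro!: closedin_diff)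
  moreover have inv: "act g x \<in> ?C" if "g \<in> G" "x \<in> ?C" for g x
    using that act_in[of g x] act_comp[of _ g x] comp_G[OF _ that(1)] by (auto simp: V_def) metis
  ultimately have "?C = {} \<or> ?C = topspace X"
    using minimal[unfolded minimal_flow_def, THEN conjunct2, THEN conjunct2, rule_format, of ?C]
    by metis
  moreover have "?C \<noteq> topspace X"
  proof -
    obtain u where "u \<in> U" using ne by blast
    then have "u \<in> topspace X" "u \<in> V id" using openin_subset[OF U] act_id[of u] by (auto simp: V_def)
    then show ?thesis using id_G by blast
  qed
  ultimately have cov: "topspace X \<subseteq> \<Union>(V ` G)" by blast
  have "compact_space X" using flow by (simp add: G_flow_def)
  then have "\<exists>\<F>. finite \<F> \<and> \<F> \<subseteq> V ` G \<and> topspace X \<subseteq> \<Union>\<F>"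
    unfolding compact_space_def by (rule compactinD) (use opV cov in auto)
  then obtain \<F> where \<F>: "finite \<F>" "\<F> \<subseteq> V ` G" "topspace X \<subseteq> \<Union>\<F>" by blast
  then obtain F where F: "finite F" "F \<subseteq> G" "\<F> = V ` F" by (meson finite_subset_image)
  have "\<exists>g\<in>F. act g x \<in> U" if "x \<in> topspace X" for x
    using that \<F>(3) F(3) by (auto simp: V_def)
  then show ?thesis using F(1,2) by blast
qed

text \<open>A translate of \<open>A\<close> is coloured by whether moving it back to
  \<open>A\<close> takes a fixed base point into \<open>U\<close>. On a homogeneous set, finitely
  many elements that cover \<open>X\<close> by preimages of \<open>U\<close> and of \<open>V\<close>
  receive the same colour, so a point that is moved into \<open>V\<close> is moved into
  \<open>U\<close> as well.\<close>

lemma setstab_transitive: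
  assumes A: "finite A" and U: "openin X U" "U \<noteq> {}" and V: "openin X V" "V \<noteq> {}"
    and invU: "\<And>g x. g \<in> setstab A \<Longrightarrow> x \<in> U \<Longrightarrow> act g x \<in> U"
  shows "\<exists>g\<in>setstab A. \<exists>x\<in>V. act g x \<in> U"
proof (rule ccontr)
  assume con: "\<not> ?thesis"
  obtain F1 where F1: "finite F1" "F1 \<subseteq> G" "\<And>x. x \<in> topspace X \<Longrightarrow> \<exists>g\<in>F1. act g x \<in> U"
    using finite_translates_cover[OF U] by auto
  obtain F2 where F2: "finite F2" "F2 \<subseteq> G" "\<And>x. x \<in> topspace X \<Longrightarrow> \<exists>g\<in>F2. act g x \<in> V"
    using finite_translates_cover[OF V] by auto
  obtain x where x: "x \<in> topspace X" using nonempty by blast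
  \<comment> \<open>Since \<open>U\<close> is invariant under \<open>setstab A\<close>, the colour
    does not depend on which \<open>g\<close> carries \<open>S\<close> back to \<open>A\<close>;
    this is the equivalence proved below.\<close>
  define col where "col S \<longleftrightarrow> (\<exists>g\<in>G. g ` S = A \<and> act g x \<in> U)" for S
  \<comment> \<open>\<open>B\<close> contains the preimage of \<open>A\<close> under every covering
    element, so one homogeneous translate of \<open>B\<close> decides them all.\<close>
  define B where "B = (\<Union>g\<in>F1 \<union> F2. inv g ` A)"
  have finB: "finite B" using F1 F2 A by (simp add: B_def)
  from ramsey[OF A finB, of col] obtain h c where h: "h \<in> G"
    and hc: "\<forall>g\<in>G. g ` A \<subseteq> h ` B \<longrightarrow> col (g ` A) = c" by (elim bexE exE)
  have col: "col ((h \<circ> inv g) ` A) \<longleftrightarrow> act (g \<circ> inv h) x \<in> U" if "g \<in> G" for g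
  proof
    have k: "g \<circ> inv h \<in> G" using that h comp_G inv_G by blast
    have "(g \<circ> inv h) \<circ> (h \<circ> inv g) = id"
      using that h by (auto simp: inv_simps)
    then have "(g \<circ> inv h) ` (h \<circ> inv g) ` A = A"
      by (simp only: image_comp image_id id_apply)
    then show "col ((h \<circ> inv g) ` A)" if "act (g \<circ> inv h) x \<in> U"
      unfolding col_def using that k by blast
    assume "col ((h \<circ> inv g) ` A)"
    then obtain k where kG: "k \<in> G" and kA: "k ` (h \<circ> inv g) ` A = A" and kx: "act k x \<in> U"
      by (auto simp: col_def)
    define l where "l = g \<circ> inv h \<circ> inv k"
    have lG: "l \<in> G" using that h kG comp_G inv_G by (simp add: l_def)
    have "l \<circ> (k \<circ> (h \<circ> inv g)) = id"
      using that h kG by (auto simp: l_def inv_simps)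
    then have "l ` k ` (h \<circ> inv g) ` A = A" by (simp only: image_comp image_id id_apply)
    then have "l ` A = A" using kA by simp
    then have "l \<in> setstab A" using lG by (simp add: setstab_def)
    then have "act l (act k x) \<in> U" using invU kx by blast
    moreover have "l \<circ> k = g \<circ> inv h" using kG inv_simps by (auto simp: l_def)
    ultimately show "act (g \<circ> inv h) x \<in> U" using act_comp[OF lG kG x] by simp
  qed
  have sub: "(h \<circ> inv g) ` A \<subseteq> h ` B" if "g \<in> F1 \<union> F2" for g
    using that by (auto simp: B_def)
  \<comment> \<open>Homogeneity holds on the translate of \<open>B\<close> by \<open>h\<close>;
    moving the base point back by \<open>h\<close> compensates for this.\<close>
  let ?y = "act (inv h) x"
  have y: "?y \<in> topspace X" using act_in h inv_G x by blast
  have ac: "act (g \<circ> inv h) x = act g ?y" if "g \<in> G" for g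
    using act_comp[OF that inv_G[OF h] x] .
  obtain g1 where g1: "g1 \<in> F1" "act g1 ?y \<in> U" using F1(3) y by blast
  obtain g2 where g2: "g2 \<in> F2" "act g2 ?y \<in> V" using F2(3) y by blast
  have G: "g1 \<in> G" "g2 \<in> G" using g1 g2 F1 F2 by auto
  have "col ((h \<circ> inv g1) ` A)" using col ac g1 G by simp
  then have "col ((h \<circ> inv g2) ` A)"
    using bspec[OF hc, of "h \<circ> inv g1"] bspec[OF hc, of "h \<circ> inv g2"] sub g1 g2 G comp_G h inv_G
    by (simp del: image_comp)
  then have "act g2 ?y \<in> U" using col ac G by simp
  \<comment> \<open>The witness is \<open>id\<close>: an invariant nonempty open set meets
    \<open>V\<close> itself.\<close>
  then show False using con g2 id_setstab act_id y act_in G by fastforce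
qed

end

subsection \<open>The flow of linear orders\<close>

text \<open>Zorn's lemma is applied to the complements of invariant closed sets: by compactness a
  chain of proper open sets has a proper union.\<close>

lemma minimal_subflow:
  assumes flow: "G_flow G X act" and ne: "topspace X \<noteq> {}"
  shows "\<exists>M. M \<subseteq> topspace X \<and> minimal_flow G (subtopology X M) act"
proof -
  have comp: "compact_space X" and haus: "Hausdorff_space X"
    and cont: "continuous_map (prod_topology (ptwise_top G) X) X (\<lambda>(g,x). act g x)"
    and act_id: "\<And>x. x \<in> topspace X \<Longrightarrow> act id x = x"
    and act_comp: "\<And>g h x. g \<in> G \<Longrightarrow> h \<in> G \<Longrightarrow> x \<in> topspace X \<Longrightarrow> act (g \<circ> h) x = act g (act h x)"
    using flow by (auto simp: G_flow_def)
  note act_in = G_flow_act_in[OF flow]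
  define \<A> where "\<A> = {U. openin X U \<and> U \<noteq> topspace X \<and>
    (\<forall>g\<in>G. \<forall>x\<in>topspace X - U. act g x \<in> topspace X - U)}"
  have "\<exists>U\<in>\<A>. \<forall>V\<in>\<A>. U \<subseteq> V \<longrightarrow> V = U"
  proof (rule subset_Zorn_nonempty)
    have "{} \<in> \<A>" using ne[symmetric] act_in unfolding \<A>_def by (simp add: del: null_topspace_iff_trivial)
    then show "\<A> \<noteq> {}" by blast
    fix \<C> assume \<C>: "\<C> \<noteq> {}" "subset.chain \<A> \<C>"
    then have sub: "\<C> \<subseteq> \<A>" by (simp add: subset.chain_def)
    have "openin X (\<Union>\<C>)" using sub by (auto simp: \<A>_def intro!: openin_Union)
    moreover have "\<Union>\<C> \<noteq> topspace X"
    proof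
      assume eq: "\<Union>\<C> = topspace X"
      have "\<exists>\<F>. finite \<F> \<and> \<F> \<subseteq> \<C> \<and> topspace X \<subseteq> \<Union>\<F>"
        using comp unfolding compact_space_def
        by (rule compactinD) (use sub eq in \<open>auto simp: \<A>_def\<close>)
      then obtain \<F> where \<F>: "finite \<F>" "\<F> \<subseteq> \<C>" "topspace X \<subseteq> \<Union>\<F>" by blast
      have "\<F> \<noteq> {}" using \<F>(3) ne by auto
      moreover have "subset.chain \<A> \<F>" using \<C>(2) \<F>(2) unfolding subset.chain_def by blast
      ultimately have "\<Union>\<F> \<in> \<F>" using Union_in_chain \<F>(1) by blast
      then have "\<Union>\<F> \<in> \<A>" using \<F>(2) sub by blast
      then show False using \<F>(3) openin_subset[of X "\<Union>\<F>"] by (auto simp: \<A>_def)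
    qed
    moreover have "act g x \<in> topspace X - \<Union>\<C>" if "g \<in> G" "x \<in> topspace X - \<Union>\<C>" for g x
      using that sub act_in unfolding \<A>_def by blast
    ultimately show "\<Union>\<C> \<in> \<A>" by (simp add: \<A>_def)
  qed
  then obtain U where U: "U \<in> \<A>" and max: "\<And>V. V \<in> \<A> \<Longrightarrow> U \<subseteq> V \<Longrightarrow> V = U" by blast
  define M where "M = topspace X - U"
  have opU: "openin X U" and neU: "U \<noteq> topspace X" and invM: "\<And>g x. g \<in> G \<Longrightarrow> x \<in> M \<Longrightarrow> act g x \<in> M"
    using U by (auto simp: \<A>_def M_def)
  have MX: "M \<subseteq> topspace X" by (auto simp: M_def)
  have clM: "closedin X M" using opU by (simp add: M_def closedin_diff)
  have tM: "topspace (subtopology X M) = M" using MX by auto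
  have "G_flow G (subtopology X M) act"
  proof -
    have "compact_space (subtopology X M)"
      using closedin_compact_space[OF comp clM] by (simp add: compact_space_subtopology)
    moreover have "Hausdorff_space (subtopology X M)"
      using haus by (rule Hausdorff_space_subtopology)
    moreover have "continuous_map (prod_topology (ptwise_top G) (subtopology X M)) (subtopology X M) (\<lambda>(g,x). act g x)"
      unfolding prod_topology_subtopology
      using cont invM by (auto simp: continuous_map_in_subtopology ptwise_top_def
          intro: continuous_map_from_subtopology)
    ultimately show ?thesis using act_id act_comp MX by (auto simp: G_flow_def tM)
  qed
  moreover have "M \<noteq> {}" using neU openin_subset[OF opU] by (auto simp: M_def)
  moreover have "C = {} \<or> C = M"
    if C: "closedin (subtopology X M) C" "\<forall>g\<in>G. \<forall>x\<in>C. act g x \<in> C" for C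
  proof (cases "C = {}")
    case False
    have clC: "closedin X C" and CM: "C \<subseteq> M" using C(1) by (simp_all add: closedin_closed_subtopology[OF clM])
    have "topspace X - (topspace X - C) = C" using CM MX by blast
    then have "topspace X - C \<in> \<A>" using clC False C(2) closedin_subset[OF clC] by (auto simp: \<A>_def)
    then have "topspace X - C = U" by (rule max) (use CM openin_subset[OF opU] in \<open>auto simp: M_def\<close>)
    then show ?thesis using closedin_subset[OF clC] by (auto simp: M_def)
  qed simp
  ultimately have "minimal_flow G (subtopology X M) act"
    unfolding minimal_flow_def tM by blast
  then show ?thesis using MX by blast
qed

text \<open>Universality quantifies over flows on one fixed type, so a flow on another carrier has
  to be copied there along an injection before a factor map is available.\<close>

lemma minimal_flow_transport:
  fixes e :: "'x \<Rightarrow> 'y"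
  assumes min: "minimal_flow G X act" and inj: "inj_on e (topspace X)"
  defines "d \<equiv> inv_into (topspace X) e"
  shows "minimal_flow G (pullback_topology (e ` topspace X) d X) (\<lambda>g y. e (act g (d y)))"
proof -
  let ?Y = "pullback_topology (e ` topspace X) d X"
  have flow: "G_flow G X act" and ne: "topspace X \<noteq> {}"
    and mn: "\<And>C. closedin X C \<Longrightarrow> (\<And>g x. g \<in> G \<Longrightarrow> x \<in> C \<Longrightarrow> act g x \<in> C) \<Longrightarrow> C = {} \<or> C = topspace X"
    using min unfolding minimal_flow_def by blast+
  have comp: "compact_space X" and haus: "Hausdorff_space X"
    and cont: "continuous_map (prod_topology (ptwise_top G) X) X (\<lambda>(g,x). act g x)"
    and act_id: "\<And>x. x \<in> topspace X \<Longrightarrow> act id x = x"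
    and act_comp: "\<And>g h x. g \<in> G \<Longrightarrow> h \<in> G \<Longrightarrow> x \<in> topspace X \<Longrightarrow> act (g \<circ> h) x = act g (act h x)"
    using flow by (auto simp: G_flow_def)
  note act_in = G_flow_act_in[OF flow]
  have de: "d (e x) = x" if "x \<in> topspace X" for x using that inj by (simp add: d_def)
  have ed: "e (d y) = y" "d y \<in> topspace X" if "y \<in> e ` topspace X" for y
    using that de by auto
  have tY: "topspace ?Y = e ` topspace X" using ed by (auto simp: topspace_pullback_topology)
  have contd: "continuous_map ?Y X d"
    using continuous_map_pullback[OF continuous_map_id, of "e ` topspace X" d X] by simp
  have conte: "continuous_map X ?Y e"
  proof (rule continuous_map_pullback')
    show "continuous_map X X (d \<circ> e)"
      using continuous_map_eq[OF continuous_map_id, of X "d \<circ> e"] de by simp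
  qed auto
  have hom: "X homeomorphic_space ?Y"
    unfolding homeomorphic_space_def homeomorphic_maps_def
    using conte contd de ed tY by (intro exI[of _ e] exI[of _ d]) auto
  have contY: "continuous_map (prod_topology (ptwise_top G) ?Y) ?Y (\<lambda>(g,y). e (act g (d y)))"
  proof -
    have "continuous_map (prod_topology (ptwise_top G) ?Y) (prod_topology (ptwise_top G) X)
        (\<lambda>p. (fst p, (d \<circ> snd) p))"
      by (intro continuous_map_pairedI continuous_map_fst continuous_map_compose[OF continuous_map_snd contd])
    from continuous_map_compose[OF continuous_map_compose[OF this cont] conte]
    show ?thesis by (simp add: o_def case_prod_unfold)
  qed
  have "G_flow G ?Y (\<lambda>g y. e (act g (d y)))"
    unfolding G_flow_def tY using comp haus contY hom act_id act_comp act_in de ed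
    by (auto simp: homeomorphic_compact_space[OF hom] homeomorphic_Hausdorff_space[OF hom])
  moreover have "C = {} \<or> C = e ` topspace X"
    if C: "closedin ?Y C" "\<forall>g\<in>G. \<forall>y\<in>C. e (act g (d y)) \<in> C" for C
  proof -
    have CY: "C \<subseteq> e ` topspace X" using closedin_subset[OF C(1)] tY by simp
    let ?D = "{x\<in>topspace X. e x \<in> C}"
    have "closedin X ?D" using closedin_continuous_map_preimage[OF conte C(1)] .
    then have "?D = {} \<or> ?D = topspace X"
      by (rule mn) (use C(2) act_in de in \<open>fastforce\<close>)
    then show ?thesis using CY by auto
  qed
  ultimately show ?thesis using ne unfolding minimal_flow_def tY by blast
qed

section \<open>The compact space of linear orders\<close>

definition strict_linear :: "('a \<times> 'a \<Rightarrow> bool) \<Rightarrow> bool" where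
  "strict_linear f \<longleftrightarrow> (\<forall>i. \<not> f (i, i)) \<and> (\<forall>i j k. f (i, j) \<longrightarrow> f (j, k) \<longrightarrow> f (i, k)) \<and>
     (\<forall>i j. i \<noteq> j \<longrightarrow> f (i, j) \<or> f (j, i))"

text \<open>Orders are predicates on pairs, and so points of a compact product of two-point spaces
  in which the linear ones form a closed set.\<close>

definition order_top :: "(nat \<times> nat \<Rightarrow> bool) topology" where
  "order_top = subtopology (product_topology (\<lambda>_. discrete_topology UNIV) UNIV) {f. strict_linear f}"

definition order_act :: "(nat \<Rightarrow> nat) \<Rightarrow> (nat \<times> nat \<Rightarrow> bool) \<Rightarrow> (nat \<times> nat \<Rightarrow> bool)" where
  "order_act g f = (\<lambda>(i, j). f (inv g i, inv g j))"

lemma topspace_order_top: "topspace order_top = {f. strict_linear f}"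
  by (simp add: order_top_def)

lemma open_order_top: "openin order_top {f. strict_linear f \<and> f p \<in> U}"
proof -
  have "continuous_map order_top (discrete_topology UNIV) (\<lambda>f. f p)"
    unfolding order_top_def
    by (intro continuous_map_from_subtopology continuous_map_product_projection) auto
  then have "openin order_top {f\<in>topspace order_top. f p \<in> U}"
    by (rule openin_continuous_map_preimage) auto
  then show ?thesis by (simp add: topspace_order_top)
qed

lemma closedin_strict_linear:
  "closedin (product_topology (\<lambda>_. discrete_topology (UNIV::bool set)) (UNIV::(nat \<times> nat) set)) {f. strict_linear f}"
    (is "closedin ?T _")
proof -
  have cl: "closedin ?T {f. f p \<in> U}" for p U
  proof -
    have "continuous_map ?T (discrete_topology UNIV) (\<lambda>f. f p)"
      by (intro continuous_map_product_projection) auto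
    then have "closedin ?T {f\<in>topspace ?T. f p \<in> U}"
      by (rule closedin_continuous_map_preimage) auto
    then show ?thesis by simp
  qed
  \<comment> \<open>The set \<open>{True, i \<noteq> j}\<close> is everything for
    \<open>i = j\<close>, where totality demands nothing, and \<open>{True}\<close>
    otherwise.\<close>
  have "{f. strict_linear f} = (\<Inter>i. {f. f (i, i) \<in> {False}}) \<inter>
     ((\<Inter>(i, j, k). {f. f (i, j) \<in> {False}} \<union> {f. f (j, k) \<in> {False}} \<union> {f. f (i, k) \<in> {True}}) \<inter>
      (\<Inter>(i, j). {f. f (i, j) \<in> {True}} \<union> {f. f (j, i) \<in> {True, i \<noteq> j}}))"
    by (auto simp: strict_linear_def)
  also have "closedin ?T \<dots>"
    by (intro closedin_Int closedin_INT) (auto simp: split_beta intro!: closedin_Un cl simp del: insert_iff)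
  finally show ?thesis .
qed

lemma order_flow:
  assumes "ramsey_group G"
  shows "G_flow G order_top order_act"
proof -
  interpret ramsey_group G by fact
  have "compact_space order_top"
    unfolding order_top_def
    by (intro compact_space_subtopology closedin_compact_space closedin_strict_linear)
      (simp add: compact_space_product_topology compact_space_discrete_topology)
  moreover have "Hausdorff_space order_top"
    unfolding order_top_def
    by (intro Hausdorff_space_subtopology) (auto simp: Hausdorff_space_product_topology)
  moreover have lin: "strict_linear (order_act g f)" if "g \<in> G" "strict_linear f" for g f
    using that bij_imp_bij_inv[OF bij_G[OF that(1)]]
    by (auto simp: strict_linear_def order_act_def bij_def inj_eq)
  moreover have "continuous_map (prod_topology (ptwise_top G) order_top) order_top (\<lambda>(g,f). order_act g f)"
  proof -
    have "openin (prod_topology (ptwise_top G) order_top)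
        {p\<in>topspace (prod_topology (ptwise_top G) order_top). (case p of (g, f) \<Rightarrow> order_act g f) (i, j) \<in> U}"
      for i j U
    proof -
      have opg: "openin (ptwise_top G) {g\<in>G. g k = i}" for k i
      proof -
        have "continuous_map (ptwise_top G) (discrete_topology UNIV) (\<lambda>g. g k)"
          unfolding ptwise_top_def
          by (intro continuous_map_from_subtopology continuous_map_product_projection) auto
        then have "openin (ptwise_top G) {g\<in>topspace (ptwise_top G). g k \<in> {i}}"
          by (rule openin_continuous_map_preimage) auto
        then show ?thesis by (simp add: ptwise_top_def)
      qed
      \<comment> \<open>The preimages of \<open>i\<close> and \<open>j\<close> under
        \<open>g\<close> are guessed as \<open>k\<close> and \<open>l\<close>: for fixed guesses the
        condition is a product of open sets in which no inverse occurs.\<close>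
      have "{p\<in>topspace (prod_topology (ptwise_top G) order_top). (case p of (g, f) \<Rightarrow> order_act g f) (i, j) \<in> U}
        = (\<Union>(k, l). ({g\<in>G. g k = i} \<inter> {g\<in>G. g l = j}) \<times> {f. strict_linear f \<and> f (k, l) \<in> U})"
        by (force simp: topspace_order_top ptwise_top_def order_act_def inv_simps)
      also have "openin (prod_topology (ptwise_top G) order_top) \<dots>"
        using opg open_order_top by (intro openin_Union) (auto simp: openin_prod_Times_iff intro!: openin_Int)
      finally show ?thesis .
    qed
    then have "continuous_map (prod_topology (ptwise_top G) order_top)
        (product_topology (\<lambda>_. discrete_topology UNIV) UNIV) (\<lambda>(g,f). order_act g f)"
      unfolding continuous_map_componentwise_UNIV by (auto simp: continuous_map_def)
    then show ?thesis
      using lin unfolding order_top_def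
      by (auto simp: continuous_map_in_subtopology ptwise_top_def)
  qed
  moreover have "order_act id f = f" for f
    by (auto simp: order_act_def inv_id)
  moreover have "order_act (g \<circ> h) f = order_act g (order_act h f)" if "g \<in> G" "h \<in> G" for g h f
    using that bij_G by (auto simp: order_act_def o_inv_distrib)
  ultimately show ?thesis by (simp add: G_flow_def)
qed

text \<open>The factor map onto a copy of a minimal subflow of orders, followed by decoding, is
  continuous and equivariant; \<open>r\<close> reads off its coordinates.\<close>

lemma universal_minimal_flow_order:
  assumes G: "ramsey_group G" and univ: "universal_minimal_flow G X act"
  shows "\<exists>r :: 'x \<Rightarrow> nat \<Rightarrow> nat \<Rightarrow> bool.
    (\<forall>x\<in>topspace X. strict_linear (\<lambda>(i, j). r x i j)) \<and>
    (\<forall>i j. openin X {x\<in>topspace X. r x i j}) \<and>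
    (\<forall>g\<in>G. \<forall>x\<in>topspace X. \<forall>i j. r (act g x) (g i) (g j) = r x i j)"
proof -
  interpret ramsey_group G by fact
  have "(\<lambda>(i, j). i < j) \<in> topspace order_top" by (auto simp: topspace_order_top strict_linear_def)
  then have "topspace order_top \<noteq> {}" by blast
  from minimal_subflow[OF order_flow[OF G] this] obtain M
    where M: "M \<subseteq> topspace order_top" and minM: "minimal_flow G (subtopology order_top M) order_act"
    by blast
  let ?Z = "subtopology order_top M"
  have tZ: "topspace ?Z = M" using M by auto
  \<comment> \<open>universality only speaks about flows on this type\<close>
  define e :: "(nat \<times> nat \<Rightarrow> bool) \<Rightarrow> (nat \<Rightarrow> nat) set set" where
    "e = (\<lambda>f. (\<lambda>p. {\<lambda>_. prod_encode p}) ` {p. f p})"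
  have "inj e"
  proof (rule injI)
    fix f f' assume eq: "e f = e f'"
    have "inj (\<lambda>p. {\<lambda>_::nat. prod_encode p})"
      by (rule injI) (metis prod_encode_inverse singleton_inject)
    then have "{p. f p} = {p. f' p}" using eq unfolding e_def by (simp add: inj_image_eq_iff)
    then show "f = f'" by auto
  qed
  then have inj: "inj_on e (topspace ?Z)" by (auto intro: inj_on_subset)
  define d where "d = inv_into (topspace ?Z) e"
  let ?Y = "pullback_topology (e ` topspace ?Z) d ?Z"
  have "minimal_flow G ?Y (\<lambda>g y. e (order_act g (d y)))"
    unfolding d_def by (rule minimal_flow_transport[OF minM inj])
  then obtain \<pi> where \<pi>: "flow_factor G X act ?Y (\<lambda>g y. e (order_act g (d y))) \<pi>"
    using univ unfolding universal_minimal_flow_def by blast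
  have contd: "continuous_map ?Y ?Z d"
    using continuous_map_pullback[OF continuous_map_id, of "e ` topspace ?Z" d ?Z] by simp
  have cont: "continuous_map X ?Z (d \<circ> \<pi>)"
    using \<pi> contd by (auto simp: flow_factor_def intro: continuous_map_compose)
  then have in_M: "d (\<pi> x) \<in> M" if "x \<in> topspace X" for x
    using that tZ by (auto simp: continuous_map_def)
  have equi: "d (\<pi> (act g x)) = order_act g (d (\<pi> x))" if g: "g \<in> G" and x: "x \<in> topspace X" for g x
  proof -
    have gf: "G_flow G ?Z order_act" using minM by (simp add: minimal_flow_def)
    have "order_act g (d (\<pi> x)) \<in> topspace ?Z"
      using G_flow_act_in[OF gf g] in_M[OF x] tZ by blast
    moreover have "\<pi> (act g x) = e (order_act g (d (\<pi> x)))"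
      using \<pi> g x by (simp add: flow_factor_def)
    ultimately show ?thesis using inj by (simp add: d_def)
  qed
  define r where "r x i j = d (\<pi> x) (i, j)" for x i j
  have "strict_linear (\<lambda>(i, j). r x i j)" if "x \<in> topspace X" for x
    using in_M[OF that] M by (auto simp: r_def topspace_order_top case_prod_eta)
  moreover have "openin X {x\<in>topspace X. r x i j}" for i j
  proof -
    have "continuous_map X order_top (d \<circ> \<pi>)"
      using cont by (simp add: continuous_map_in_subtopology)
    from openin_continuous_map_preimage[OF this open_order_top[of "(i, j)" "{True}"]]
    show ?thesis using in_M M
      by (auto simp: r_def topspace_order_top elim!: rev_iffD1[OF _ arg_cong[where f="openin X"]])
  qed
  moreover have "r (act g x) (g i) (g j) = r x i j" if "g \<in> G" "x \<in> topspace X" for g x i j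
    using that by (simp add: r_def equi order_act_def inv_simps)
  ultimately show ?thesis by blast
qed

subsection \<open>Ordered flows and their invariant measures\<close>

text \<open>An automorphism preserves the number of predecessors, and in a finite linear order this
  number determines the element.\<close>

lemma finite_order_rigid:
  assumes fin: "finite A" and irr: "\<And>i. i \<in> A \<Longrightarrow> \<not> R i i"
    and tr: "\<And>i j k. R i j \<Longrightarrow> R j k \<Longrightarrow> R i k"
    and tot: "\<And>i j. i \<in> A \<Longrightarrow> j \<in> A \<Longrightarrow> i \<noteq> j \<Longrightarrow> R i j \<or> R j i"
    and k: "k ` A = A" "inj_on k A" "\<And>i j. i \<in> A \<Longrightarrow> j \<in> A \<Longrightarrow> R (k i) (k j) = R i j"
    and a: "a \<in> A"
  shows "k a = a"
proof -
  define pre where "pre b = {j\<in>A. R j b}" for b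
  have im: "pre (k a) = k ` pre a"
    using k a by (auto simp: pre_def image_iff) (metis imageE)
  have c: "card (pre (k a)) = card (pre a)"
    unfolding im by (rule card_image) (use k(2) in \<open>auto simp: pre_def inj_on_def\<close>)
  have less: "card (pre b) < card (pre b')" if "b \<in> A" "b' \<in> A" "R b b'" for b b'
  proof (rule psubset_card_mono)
    have "b \<in> pre b'" "b \<notin> pre b" "pre b \<subseteq> pre b'" using that irr tr by (auto simp: pre_def)
    then show "pre b \<subset> pre b'" by blast
  qed (simp add: pre_def fin)
  show ?thesis using less[of a "k a"] less[of "k a" a] tot[of a "k a"] a k(1) c by (metis imageI less_irrefl)
qed

text \<open>Universality enters the rest of the argument only through \<open>r\<close>, a continuous
  equivariant map from \<open>X\<close> into the linear orders.\<close>

locale ordered_flow = ramsey_flow G X act for G and X :: "'x topology" and act +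
  fixes r :: "'x \<Rightarrow> nat \<Rightarrow> nat \<Rightarrow> bool"
  assumes r_linear: "x \<in> topspace X \<Longrightarrow> strict_linear (\<lambda>(i, j). r x i j)"
    and open_r: "openin X {x\<in>topspace X. r x i j}"
    and r_act: "g \<in> G \<Longrightarrow> x \<in> topspace X \<Longrightarrow> r (act g x) (g i) (g j) = r x i j"
begin

lemma r_irrefl: "x \<in> topspace X \<Longrightarrow> \<not> r x i i"
  and r_trans: "x \<in> topspace X \<Longrightarrow> r x i j \<Longrightarrow> r x j k \<Longrightarrow> r x i k"
  and r_total: "x \<in> topspace X \<Longrightarrow> i \<noteq> j \<Longrightarrow> r x i j \<or> r x j i"
  using r_linear[of x] unfolding strict_linear_def by (simp, blast, auto)

lemma r_asym: "x \<in> topspace X \<Longrightarrow> r x i j \<Longrightarrow> \<not> r x j i"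
  using r_irrefl r_trans by blast

lemma not_r_iff: "x \<in> topspace X \<Longrightarrow> i \<noteq> j \<Longrightarrow> \<not> r x i j \<longleftrightarrow> r x j i"
  using r_asym r_total by blast

lemma r_act': "g \<in> G \<Longrightarrow> x \<in> topspace X \<Longrightarrow> r (act g x) i j = r x (inv g i) (inv g j)"
  using r_act[of g x "inv g i" "inv g j"] by (simp add: inv_simps)

definition agree :: "nat set \<Rightarrow> 'x \<Rightarrow> 'x \<Rightarrow> bool" where
  "agree D x y \<longleftrightarrow> (\<forall>i\<in>D. \<forall>j\<in>D. r x i j = r y i j)"

definition cyl :: "nat set \<Rightarrow> 'x \<Rightarrow> 'x set" where
  "cyl D x = {y\<in>topspace X. agree D x y}"

lemma agree_refl: "agree D x x" by (simp add: agree_def)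

lemma agree_sym: "agree D x y \<Longrightarrow> agree D y x" by (simp add: agree_def)

lemma agree_trans: "agree D x y \<Longrightarrow> agree D y z \<Longrightarrow> agree D x z" by (simp add: agree_def)

lemma agree_mono: "agree D x y \<Longrightarrow> C \<subseteq> D \<Longrightarrow> agree C x y" by (auto simp: agree_def)

lemma agree_act_image:
  "g \<in> G \<Longrightarrow> x \<in> topspace X \<Longrightarrow> y \<in> topspace X \<Longrightarrow> agree (g ` D) (act g x) (act g y) \<longleftrightarrow> agree D x y"
  by (simp add: agree_def r_act)

lemma agree_setstab:
  "g \<in> setstab D \<Longrightarrow> x \<in> topspace X \<Longrightarrow> y \<in> topspace X \<Longrightarrow> agree D (act g x) (act g y) \<longleftrightarrow> agree D x y"
  using agree_act_image[of g x y D] by (simp add: setstab_def)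

lemma open_r_eq: "openin X {x\<in>topspace X. r x i j = b}"
proof (cases b)
  case False
  have "{x\<in>topspace X. r x i j = b} = (if i = j then topspace X else {x\<in>topspace X. r x j i})"
    using False r_asym by (auto simp: r_irrefl not_r_iff)
  then show ?thesis using open_r by simp
qed (simp add: open_r)

lemma open_cyl: assumes "finite D" shows "openin X (cyl D x)"
proof -
  have "cyl D x = topspace X \<inter> (\<Inter>p\<in>D \<times> D. {y\<in>topspace X. r y (fst p) (snd p) = r x (fst p) (snd p)})"
    by (auto simp: cyl_def agree_def)
  also have "openin X \<dots>"
    using assms open_r_eq by (cases "D = {}") (auto intro!: openin_Int openin_INT2)
  finally show ?thesis .
qed

lemma cyl_self: "x \<in> topspace X \<Longrightarrow> x \<in> cyl D x" by (simp add: cyl_def agree_refl)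

lemma open_if_finitary:
  assumes "finite D" "E \<subseteq> topspace X"
    and "\<And>x y. x \<in> E \<Longrightarrow> y \<in> topspace X \<Longrightarrow> agree D x y \<Longrightarrow> y \<in> E"
  shows "openin X E"
proof (subst openin_subopen, intro ballI)
  fix x assume "x \<in> E"
  then show "\<exists>T. openin X T \<and> x \<in> T \<and> T \<subseteq> E"
    using assms open_cyl[OF assms(1), of x] cyl_self by (intro exI[of _ "cyl D x"]) (auto simp: cyl_def)
qed

text \<open>The points whose order on \<open>D\<close> can be carried to that of \<open>y\<close>
  form an open set invariant under \<open>setstab D\<close>. It contains \<open>y\<close>, so by
  transitivity the cylinder of \<open>x\<close> reaches it.\<close>

lemma setstab_agree:
  assumes D: "finite D" and x: "x \<in> topspace X" and y: "y \<in> topspace X"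
  shows "\<exists>g\<in>setstab D. agree D (act g x) y"
proof -
  define U where "U = {z\<in>topspace X. \<exists>h\<in>setstab D. agree D (act h z) y}"
  have opU: "openin X U"
  proof (rule open_if_finitary[OF D])
    show "z' \<in> U" if "z \<in> U" "z' \<in> topspace X" "agree D z z'" for z z'
      using that agree_setstab[of _ D z z'] agree_sym agree_trans unfolding U_def by blast
  qed (auto simp: U_def)
  have neU: "U \<noteq> {}" using y act_id[OF y] id_setstab agree_refl unfolding U_def by force
  have invU: "act g z \<in> U" if g: "g \<in> setstab D" and z: "z \<in> U" for g z
  proof -
    obtain h where h: "h \<in> setstab D" "agree D (act h z) y" and zX: "z \<in> topspace X"
      using z by (auto simp: U_def)
    have G: "g \<in> G" "h \<in> G" using g h setstab_G by auto
    have "act (h \<circ> inv g) (act g z) = act h z"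
      using G zX act_comp[of h "inv g" "act g z"] by (simp add: inv_G act_in act_inv)
    then show ?thesis
      using h g comp_setstab inv_setstab zX G act_in unfolding U_def by (metis (mono_tags, lifting) mem_Collect_eq)
  qed
  obtain g z where g: "g \<in> setstab D" and z: "z \<in> cyl D x" "act g z \<in> U"
    using setstab_transitive[OF D opU neU open_cyl[OF D, of x] _ invU] cyl_self[OF x] by blast
  then obtain h where h: "h \<in> setstab D" "agree D (act h (act g z)) y" and zX: "z \<in> topspace X"
    by (auto simp: U_def cyl_def)
  have k: "h \<circ> g \<in> setstab D" using g h comp_setstab by blast
  have "act (h \<circ> g) z = act h (act g z)" using act_comp zX g h setstab_G by blast
  moreover have "agree D (act (h \<circ> g) x) (act (h \<circ> g) z)"
    using agree_setstab[OF k x zX] z(1) by (simp add: cyl_def)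
  ultimately show ?thesis using k h(2) agree_trans by metis
qed

text \<open>This is the passage from setwise to pointwise stabilisers, by rigidity of finite linear
  orders.\<close>

lemma setstab_agree_imp_stab:
  assumes A: "finite A" and k: "k \<in> setstab A" and x: "x \<in> topspace X" and ag: "agree A (act k x) x"
  shows "k \<in> stab A"
proof -
  have kG: "k \<in> G" and kA: "k ` A = A" using k by (auto simp: setstab_def)
  have "k a = a" if "a \<in> A" for a
  proof (rule finite_order_rigid[OF A, of "r x"])
    show "r x (k i) (k j) = r x i j" if "i \<in> A" "j \<in> A" for i j
      using r_act[OF kG x, of i j] ag that kA unfolding agree_def by blast
    show "inj_on k A" using bij_G[OF kG] by (meson bij_is_inj inj_on_subset subset_UNIV)
  qed (use x r_irrefl r_trans r_total kA that in blast)+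
  then show ?thesis using kG by (simp add: stab_def)
qed

text \<open>Saturating \<open>U\<close> under \<open>setstab A\<close> makes
  \<open>setstab_transitive\<close> applicable. The element found moves a point of the cylinder into
  the same cylinder, so it preserves the order on \<open>A\<close> and fixes \<open>A\<close>
  pointwise.\<close>

lemma stab_transitive:
  assumes A: "finite A" and x: "x \<in> topspace X"
    and U: "openin X U" "U \<noteq> {}" "U \<subseteq> cyl A x" and V: "openin X V" "V \<noteq> {}" "V \<subseteq> cyl A x"
  shows "\<exists>g\<in>stab A. \<exists>v\<in>V. act g v \<in> U"
proof -
  define U' where "U' = {z\<in>topspace X. \<exists>h\<in>setstab A. act h z \<in> U}"
  have "U' = (\<Union>h\<in>setstab A. {z\<in>topspace X. act h z \<in> U})" by (auto simp: U'_def)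
  then have opU': "openin X U'"
    using open_act_vimage U(1) setstab_G by auto
  obtain u where u: "u \<in> U" "u \<in> topspace X" using U by (auto simp: cyl_def)
  then have neU': "U' \<noteq> {}" using act_id id_setstab unfolding U'_def by force
  have invU': "act g z \<in> U'" if g: "g \<in> setstab A" and z: "z \<in> U'" for g z
  proof -
    obtain h where h: "h \<in> setstab A" "act h z \<in> U" and zX: "z \<in> topspace X"
      using z by (auto simp: U'_def)
    have G: "g \<in> G" "h \<in> G" using g h setstab_G by auto
    have "act (h \<circ> inv g) (act g z) = act h z"
      using G zX act_comp[of h "inv g" "act g z"] by (simp add: inv_G act_in act_inv)
    then show ?thesis
      using h g comp_setstab inv_setstab zX G act_in unfolding U'_def by (metis (mono_tags, lifting) mem_Collect_eq)
  qed
  obtain g v where g: "g \<in> setstab A" and v: "v \<in> V" "act g v \<in> U'"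
    using setstab_transitive[OF A opU' neU' V(1,2) invU'] by blast
  then obtain h where h: "h \<in> setstab A" "act h (act g v) \<in> U" by (auto simp: U'_def)
  have vX: "v \<in> topspace X" and agv: "agree A x v" using v V(3) by (auto simp: cyl_def)
  have k: "h \<circ> g \<in> setstab A" using g h comp_setstab by blast
  have kv: "act (h \<circ> g) v = act h (act g v)" using act_comp vX g h setstab_G by blast
  then have "agree A x (act (h \<circ> g) v)" using h(2) U(3) by (auto simp: cyl_def)
  then have "h \<circ> g \<in> stab A"
    using setstab_agree_imp_stab[OF A k vX] agv agree_sym agree_trans by blast
  then show ?thesis using kv h(2) v(1) by metis
qed

text \<open>Disjoint neighbourhoods \<open>U\<close> and \<open>V\<close> are shrunk to
  \<open>W1\<close> and \<open>W2\<close>, which the stabiliser of a finite set \<open>A\<close>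
  keeps inside \<open>U\<close> and \<open>V\<close>. Equal orders put \<open>x\<close> and
  \<open>y\<close> into one cylinder over \<open>A\<close>, so this stabiliser moves some point of
  \<open>W2\<close> into \<open>W1\<close>; that point lies in both \<open>U\<close> and
  \<open>V\<close>.\<close>

lemma r_inj:
  assumes x: "x \<in> topspace X" and y: "y \<in> topspace X" and eq: "r x = r y"
  shows "x = y"
proof (rule ccontr)
  assume "x \<noteq> y"
  moreover have "Hausdorff_space X" using flow by (simp add: G_flow_def)
  ultimately obtain U V where U: "openin X U" "x \<in> U" and V: "openin X V" "y \<in> V" and dis: "disjnt U V"
    using x y unfolding Hausdorff_space_def by metis
  obtain A1 W1 where 1: "finite A1" "openin X W1" "x \<in> W1" "\<And>g w. g \<in> stab A1 \<Longrightarrow> w \<in> W1 \<Longrightarrow> act g w \<in> U"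
    using open_act_near_id[OF U] by blast
  obtain A2 W2 where 2: "finite A2" "openin X W2" "y \<in> W2" "\<And>g w. g \<in> stab A2 \<Longrightarrow> w \<in> W2 \<Longrightarrow> act g w \<in> V"
    using open_act_near_id[OF V] by blast
  define A where "A = A1 \<union> A2"
  have A: "finite A" using 1 2 by (simp add: A_def)
  have sub: "stab A \<subseteq> stab A1" "stab A \<subseteq> stab A2" by (auto simp: stab_def A_def)
  have ycyl: "y \<in> cyl A x" using y eq by (simp add: cyl_def agree_def)
  obtain g v where g: "g \<in> stab A" and v: "v \<in> W2 \<inter> cyl A x" "act g v \<in> W1 \<inter> cyl A x"
    using stab_transitive[OF A x, of "W1 \<inter> cyl A x" "W2 \<inter> cyl A x"] open_cyl[OF A, of x] 1(2,3) 2(2,3)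
      cyl_self[OF x, of A] ycyl by blast
  have vX: "v \<in> topspace X" using v by (simp add: cyl_def)
  have "act (inv g) (act g v) \<in> U" using 1(4) v(2) sub inv_stab[OF g] by blast
  then have "v \<in> U" using act_inv(1)[OF stab_G[OF g] vX] by simp
  moreover have "v \<in> V" using 2(4)[of id v] v(1) id_stab act_id[OF vX] by simp
  ultimately show False using dis by (auto simp: disjnt_def)
qed

text \<open>By injectivity of \<open>r\<close>, every point outside \<open>U\<close> differs from
  \<open>x\<close> in some relation. The sets \<open>E p\<close> of points that differ at
  \<open>p\<close> are open, so finitely many relations exclude the compact complement of
  \<open>U\<close>.\<close>

lemma cyl_basis:
  assumes U: "openin X U" and x: "x \<in> U"
  shows "\<exists>n. cyl {..<n} x \<subseteq> U"
proof -
  have xX: "x \<in> topspace X" using U x openin_subset by blast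
  define E where "E p = {y\<in>topspace X. r y (fst p) (snd p) = (\<not> r x (fst p) (snd p))}" for p
  have opE: "openin X (E p)" for p unfolding E_def by (rule open_r_eq)
  have "compactin X (topspace X - U)"
    using U flow by (intro closedin_compact_space) (auto simp: G_flow_def closedin_diff)
  then have "\<exists>\<F>. finite \<F> \<and> \<F> \<subseteq> range E \<and> topspace X - U \<subseteq> \<Union>\<F>"
  proof (rule compactinD)
    show "topspace X - U \<subseteq> \<Union>(range E)"
    proof
      fix y assume y: "y \<in> topspace X - U"
      then have "r x \<noteq> r y" using r_inj[OF xX, of y] x by blast
      then obtain i j where "r x i j \<noteq> r y i j" by blast
      then have "y \<in> E (i, j)" using y by (auto simp: E_def)
      then show "y \<in> \<Union>(range E)" by blast
    qed
  qed (use opE in auto)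
  then obtain \<F> where \<F>: "finite \<F>" "\<F> \<subseteq> range E" "topspace X - U \<subseteq> \<Union>\<F>" by blast
  then obtain I where I: "finite I" "\<F> = E ` I" by (metis finite_subset_image subset_UNIV)
  obtain n where n: "\<forall>i\<in>fst ` I \<union> snd ` I. i < n"
    using I(1) finite_nat_set_iff_bounded[of "fst ` I \<union> snd ` I"] by auto
  have "y \<in> U" if "y \<in> cyl {..<n} x" for y
  proof (rule ccontr)
    assume "y \<notin> U"
    then have "y \<in> \<Union>(E ` I)" using that \<F>(3) I(2) by (auto simp: cyl_def)
    then obtain p where p: "p \<in> I" "y \<in> E p" by blast
    then show False using that n by (auto simp: E_def cyl_def agree_def)
  qed
  then show ?thesis by blast
qed

lemma orbit_meets_open:
  assumes "openin X U" "U \<noteq> {}" "x \<in> topspace X"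
  shows "\<exists>g\<in>G. act g x \<in> U"
  using finite_translates_cover[OF assms(1,2)] assms(3) by blast

definition cyls :: "nat set \<Rightarrow> 'x set set" where
  "cyls D = cyl D ` topspace X"

lemma finite_cyls: assumes "finite D" shows "finite (cyls D)"
proof -
  have "cyls D \<subseteq> (\<lambda>S. {y\<in>topspace X. \<forall>i\<in>D. \<forall>j\<in>D. ((i, j) \<in> S) = r y i j}) ` Pow (D \<times> D)"
  proof
    fix C assume "C \<in> cyls D"
    then obtain x where "C = cyl D x" by (auto simp: cyls_def)
    then have "C = (\<lambda>S. {y\<in>topspace X. \<forall>i\<in>D. \<forall>j\<in>D. ((i, j) \<in> S) = r y i j}) {(i, j)\<in>D \<times> D. r x i j}"
      by (auto simp: cyl_def agree_def)
    then show "C \<in> (\<lambda>S. {y\<in>topspace X. \<forall>i\<in>D. \<forall>j\<in>D. ((i, j) \<in> S) = r y i j}) ` Pow (D \<times> D)"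
      by (rule image_eqI) auto
  qed
  then show ?thesis by (rule finite_subset) (use assms in simp)
qed

lemma cyl_eq: "y \<in> cyl D x \<Longrightarrow> cyl D y = cyl D x"
  using agree_sym agree_trans unfolding cyl_def by blast

lemma disjoint_cyls: "C \<in> cyls D \<Longrightarrow> C' \<in> cyls D \<Longrightarrow> C \<noteq> C' \<Longrightarrow> C \<inter> C' = {}"
  using cyl_eq unfolding cyls_def by blast

lemma Union_cyls: "\<Union>(cyls D) = topspace X"
  using cyl_self by (auto simp: cyls_def cyl_def)

end

section \<open>Uniform measure of cylinders\<close>

locale measured_flow = ordered_flow +
  fixes \<mu> :: "'a measure"
  assumes inv_prob: "invariant_borel_prob G X act \<mu>"
begin

sublocale prob_space \<mu>
  using inv_prob by (simp add: invariant_borel_prob_def)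

lemma sets_mu: "sets \<mu> = sets (borel_of X)"
  using inv_prob by (simp add: invariant_borel_prob_def)

lemma space_mu: "space \<mu> = topspace X"
  using sets_eq_imp_space_eq[OF sets_mu] openin_subset by (auto simp: borel_of_def space_measure_of_conv)

lemma open_measurable: "openin X U \<Longrightarrow> U \<in> sets \<mu>"
proof -
  have "{U. openin X U} \<subseteq> Pow (topspace X)" using openin_subset by blast
  then show "openin X U \<Longrightarrow> U \<in> sets \<mu>" by (simp add: sets_mu borel_of_def)
qed

lemma r_measurable [measurable]: "Measurable.pred \<mu> (\<lambda>x. r x i j)"
  using open_measurable[OF open_r[of i j]] by (simp add: pred_def space_mu)

lemma measure_act:
  assumes g: "g \<in> G" and E: "E \<in> sets \<mu>"
  shows "measure \<mu> {x\<in>topspace X. act g x \<in> E} = measure \<mu> E"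
  using inv_prob g E by (simp add: invariant_borel_prob_def measure_def)

text \<open>An element of \<open>setstab D\<close> that carries the order of \<open>x\<close> on
  \<open>D\<close> to that of \<open>y\<close> pulls the second cylinder back to the first.\<close>

lemma measure_cyl_eq:
  assumes D: "finite D" and x: "x \<in> topspace X" and y: "y \<in> topspace X"
  shows "measure \<mu> (cyl D x) = measure \<mu> (cyl D y)"
proof -
  obtain g where g: "g \<in> setstab D" "agree D (act g x) y" using setstab_agree[OF D x y] by blast
  have "cyl D x = {z\<in>topspace X. act g z \<in> cyl D y}"
  proof (rule set_eqI)
    fix z
    have "agree D x z \<longleftrightarrow> agree D y (act g z)" if z: "z \<in> topspace X"
      using agree_setstab[OF g(1) x z] g(2) unfolding agree_def by metis
    then show "z \<in> cyl D x \<longleftrightarrow> z \<in> {z\<in>topspace X. act g z \<in> cyl D y}"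
      using act_in[OF setstab_G[OF g(1)]] by (auto simp: cyl_def)
  qed
  then show ?thesis
    using measure_act[OF setstab_G[OF g(1)] open_measurable[OF open_cyl[OF D, of y]]] by simp
qed

text \<open>The cylinders over \<open>D\<close> partition \<open>X\<close> into finitely many
  equally likely pieces. The resulting value does not mention \<open>\<mu>\<close>, and uniqueness
  rests on this.\<close>

lemma measure_cyl:
  assumes D: "finite D" and x: "x \<in> topspace X"
  shows "measure \<mu> (cyl D x) = 1 / card (cyls D)"
proof -
  have "measure \<mu> (\<Union>C\<in>cyls D. C) = (\<Sum>C\<in>cyls D. measure \<mu> C)"
    by (rule finite_measure_finite_Union[OF finite_cyls[OF D]])
      (use disjoint_cyls open_measurable open_cyl[OF D] in \<open>auto simp: cyls_def disjoint_family_on_def\<close>)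
  also have "\<dots> = (\<Sum>C\<in>cyls D. measure \<mu> (cyl D x))"
  proof (rule sum.cong)
    show "measure \<mu> C = measure \<mu> (cyl D x)" if "C \<in> cyls D" for C
      using that measure_cyl_eq[OF D _ x] unfolding cyls_def by blast
  qed simp
  finally have eq: "1 = real (card (cyls D)) * measure \<mu> (cyl D x)"
    using prob_space by (simp add: Union_cyls space_mu)
  then have "real (card (cyls D)) \<noteq> 0" by (metis mult_zero_left zero_neq_one)
  then show ?thesis using eq by (simp add: nonzero_eq_divide_eq mult.commute)
qed

lemma measure_cyl_pos:
  assumes D: "finite D" and x: "x \<in> topspace X"
  shows "measure \<mu> (cyl D x) > 0"
proof -
  have "cyls D \<noteq> {}" using x by (auto simp: cyls_def)
  then show ?thesis using measure_cyl[OF D x] finite_cyls[OF D] by (simp add: card_gt_0_iff)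
qed

end

section \<open>Uniqueness of the invariant measure\<close>

context ordered_flow
begin

text \<open>Cylinders over initial segments form a countable base by \<open>cyl_basis\<close>, so
  every open set is a countable union of them.\<close>

lemma sets_borel_of_cyls:
  "sets (borel_of X) = sigma_sets (topspace X) (insert {} (\<Union>n. cyls {..<n}))"
proof -
  let ?E = "insert {} (\<Union>n. cyls {..<n})"
  have sub: "{U. openin X U} \<subseteq> Pow (topspace X)" using openin_subset by blast
  have cnt: "countable ?E" using finite_cyls by (auto intro: countable_finite)
  have "sigma_sets (topspace X) {U. openin X U} = sigma_sets (topspace X) ?E"
  proof (rule sigma_sets_eqI)
    fix U assume "U \<in> {U. openin X U}"
    then have U: "openin X U" by simp
    have "U = \<Union>{C\<in>?E. C \<subseteq> U}"
    proof
      show "U \<subseteq> \<Union>{C\<in>?E. C \<subseteq> U}"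
      proof
        fix x assume x: "x \<in> U"
        then have xX: "x \<in> topspace X" using U openin_subset by blast
        obtain n where "cyl {..<n} x \<subseteq> U" using cyl_basis[OF U x] by blast
        then show "x \<in> \<Union>{C\<in>?E. C \<subseteq> U}" using cyl_self[OF xX] xX unfolding cyls_def by blast
      qed
    qed auto
    also have "\<dots> \<in> sigma_sets (topspace X) ?E"
    proof (rule sigma_sets_UNION)
      show "countable {C\<in>?E. C \<subseteq> U}" by (rule countable_subset[OF _ cnt]) blast
      show "C \<in> sigma_sets (topspace X) ?E" if "C \<in> {C\<in>?E. C \<subseteq> U}" for C
        using that by (intro sigma_sets.Basic) blast
    qed
    finally show "U \<in> sigma_sets (topspace X) ?E" .
  next
    fix C assume "C \<in> ?E"
    then show "C \<in> sigma_sets (topspace X) {U. openin X U}"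
      using open_cyl by (auto simp: cyls_def intro!: sigma_sets.Basic)
  qed
  then show ?thesis using sub by (simp add: borel_of_def)
qed

text \<open>Two such cylinders that share a point are nested, since initial segments are;
  \<open>{}\<close> is adjoined for the disjoint ones.\<close>

lemma Int_stable_cyls: "Int_stable (insert {} (\<Union>n. cyls {..<n::nat}))"
proof (rule Int_stableI)
  fix B C assume B: "B \<in> insert {} (\<Union>n. cyls {..<n})" and C: "C \<in> insert {} (\<Union>n. cyls {..<n::nat})"
  show "B \<inter> C \<in> insert {} (\<Union>n. cyls {..<n})"
  proof (cases "B \<inter> C = {}")
    case False
    then obtain z where z: "z \<in> B" "z \<in> C" by blast
    then obtain n m x y where xy: "B = cyl {..<n} x" "C = cyl {..<m} y"
      using B C by (auto simp: cyls_def)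
    then have "B = cyl {..<n} z" "C = cyl {..<m} z" using z cyl_eq by metis+
    then have "B \<inter> C = cyl {..<max n m} z"
      by (cases "n \<le> m") (auto simp: cyl_def agree_def max_def)
    moreover have "z \<in> topspace X" using z xy by (auto simp: cyl_def)
    ultimately show ?thesis by (auto simp: cyls_def)
  qed simp
qed

lemma invariant_borel_prob_unique:
  assumes \<mu>: "invariant_borel_prob G X act \<mu>" and \<nu>: "invariant_borel_prob G X act \<nu>"
  shows "\<mu> = \<nu>"
proof -
  interpret M: measured_flow G X act r \<mu> by unfold_locales fact
  interpret N: measured_flow G X act r \<nu> by unfold_locales fact
  let ?E = "insert {} (\<Union>n. cyls {..<n::nat})"
  show ?thesis
  \<comment> \<open>Over the empty set there is nothing to compare, so \<open>cyls {..<0}\<close> is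
    \<open>{topspace X}\<close>, which serves as the countable cover by generators of finite
    measure.\<close>
  proof (rule measure_eqI_generator_eq_countable[OF Int_stable_cyls, of "topspace X" _ _ "cyls {..<0}"])
    show "?E \<subseteq> Pow (topspace X)" by (auto simp: cyls_def cyl_def)
    show "emeasure \<mu> C = emeasure \<nu> C" if "C \<in> ?E" for C
      using that M.measure_cyl N.measure_cyl
      by (auto simp: cyls_def M.emeasure_eq_measure N.emeasure_eq_measure)
    show "sets \<mu> = sigma_sets (topspace X) ?E" "sets \<nu> = sigma_sets (topspace X) ?E"
      using M.sets_mu N.sets_mu sets_borel_of_cyls by auto
    show "\<Union>(cyls {..<0}) = topspace X" by (rule Union_cyls)
    show "countable (cyls {..<0})" using finite_cyls by (simp add: countable_finite)
    show "cyls {..<0} \<subseteq> ?E" by blast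
  qed auto
qed

end

subsection \<open>Orders of pairs and triples\<close>

lemma sorted_wrt_unique:
  assumes "\<And>a b. R a b \<Longrightarrow> \<not> R b a" "sorted_wrt R xs" "sorted_wrt R ys" "set xs = set ys"
  shows "xs = ys"
  using assms(2-)
proof (induction xs arbitrary: ys)
  case (Cons a xs)
  then obtain b ys' where ys: "ys = b # ys'" by (cases ys) auto
  have "a = b"
  proof (rule ccontr)
    assume "a \<noteq> b"
    then have "b \<in> set xs" "a \<in> set ys'" using Cons.prems ys by auto
    then show False using Cons.prems ys assms(1)[of a b] by auto
  qed
  moreover have "a \<notin> set xs" "b \<notin> set ys'"
    using Cons.prems ys assms(1)[of a a] assms(1)[of b b] by auto
  ultimately have "set xs = set ys'" using Cons.prems(3) ys by (simp add: insert_ident)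
  then have "xs = ys'" using Cons.prems(1,2) ys by (intro Cons.IH) auto
  then show ?case using ys \<open>a = b\<close> by simp
qed simp

context ordered_flow
begin

definition ordered3 :: "'x \<Rightarrow> nat \<Rightarrow> nat \<Rightarrow> nat \<Rightarrow> bool" where
  "ordered3 x u v w \<longleftrightarrow> r x u v \<and> r x v w"

definition between :: "'x \<Rightarrow> nat \<Rightarrow> nat \<Rightarrow> nat \<Rightarrow> bool" where
  "between x u v w \<longleftrightarrow> ordered3 x u v w \<or> ordered3 x w v u"

definition occurs :: "nat \<Rightarrow> nat \<Rightarrow> nat \<Rightarrow> bool" where
  "occurs u v w \<longleftrightarrow> (\<exists>x\<in>topspace X. ordered3 x u v w)"

definition swappable :: "nat \<Rightarrow> nat \<Rightarrow> bool" where
  "swappable u v \<longleftrightarrow> (\<exists>x\<in>topspace X. r x u v) \<and> (\<exists>x\<in>topspace X. r x v u)"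

definition all_orders :: "nat \<Rightarrow> nat \<Rightarrow> nat \<Rightarrow> bool" where
  "all_orders u v w \<longleftrightarrow> occurs u v w \<and> occurs u w v \<and> occurs v u w \<and> occurs v w u \<and> occurs w u v \<and> occurs w v u"

text \<open>List form of \<open>setstab_agree\<close>: the image of the sorted list is sorted for
  \<open>y\<close>, and a finite set has only one sorted list.\<close>

lemma order_iso:
  assumes x: "x \<in> topspace X" and y: "y \<in> topspace X"
    and us: "sorted_wrt (r x) us" and vs: "sorted_wrt (r y) vs" and eq: "set us = set vs"
  shows "\<exists>g\<in>G. map g us = vs"
proof -
  obtain g where g: "g \<in> setstab (set us)" "agree (set us) (act g x) y"
    using setstab_agree[OF _ x y, of "set us"] by auto
  have gG: "g \<in> G" and gs: "g ` set us = set us" using g by (auto simp: setstab_def)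
  have "r y (g a) (g b)" if "a \<in> set us" "b \<in> set us" "r x a b" for a b
    using that g(2) gs r_act[OF gG x, of a b] unfolding agree_def by blast
  then have "sorted_wrt (r y) (map g us)"
    using us by (auto simp: sorted_wrt_map intro: sorted_wrt_mono_rel[of us "r x"])
  then have "map g us = vs"
    using vs eq gs r_asym[OF y] by (intro sorted_wrt_unique[of "r y"]) auto
  then show ?thesis using gG by blast
qed

lemma ordered3_act: "g \<in> G \<Longrightarrow> x \<in> topspace X \<Longrightarrow> ordered3 (act g x) (g u) (g v) (g w) = ordered3 x u v w"
  by (simp add: ordered3_def r_act)

lemma occurs_act: "g \<in> G \<Longrightarrow> occurs u v w \<Longrightarrow> occurs (g u) (g v) (g w)"
  using ordered3_act act_in unfolding occurs_def by blast

lemma swappable_act: "g \<in> G \<Longrightarrow> swappable u v \<Longrightarrow> swappable (g u) (g v)"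
  using r_act act_in unfolding swappable_def by blast

lemma occurs_iso:
  assumes "occurs u v w" "occurs a b c" "{u, v, w} = {a, b, c}"
  shows "\<exists>g\<in>G. g u = a \<and> g v = b \<and> g w = c"
proof -
  obtain x y where x: "x \<in> topspace X" "ordered3 x u v w" and y: "y \<in> topspace X" "ordered3 y a b c"
    using assms by (auto simp: occurs_def)
  have "sorted_wrt (r x) [u, v, w]" using x r_trans by (auto simp: ordered3_def)
  moreover have "sorted_wrt (r y) [a, b, c]" using y r_trans by (auto simp: ordered3_def)
  moreover have "set [u, v, w] = set [a, b, c]" using assms(3) by simp
  ultimately have "\<exists>g\<in>G. map g [u, v, w] = [a, b, c]" by (rule order_iso[OF x(1) y(1)])
  then show ?thesis by simp
qed

lemma swappable_swap:
  assumes "swappable u v" shows "\<exists>g\<in>G. g u = v \<and> g v = u"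
proof -
  obtain x y where x: "x \<in> topspace X" "r x u v" and y: "y \<in> topspace X" "r y v u"
    using assms by (auto simp: swappable_def)
  have "\<exists>g\<in>G. map g [u, v] = [v, u]"
    by (rule order_iso[OF x(1) y(1)]) (use x y in auto)
  then show ?thesis by simp
qed

lemma swappable_sym: "swappable u v \<Longrightarrow> swappable v u" by (auto simp: swappable_def)

lemma swappable_neq: "swappable u v \<Longrightarrow> u \<noteq> v" using r_irrefl by (auto simp: swappable_def)

lemma not_swappable_const:
  assumes "\<not> swappable u v" "x \<in> topspace X" "r x u v" "y \<in> topspace X"
  shows "r y u v"
  using assms r_total[of y u v] r_irrefl[of x u] unfolding swappable_def by blast

text \<open>If a came always before c, the two possible orders b, a, c and a, c, b would be related by
  a 3-cycle in the group, whose square reverses a and c.\<close>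
lemma swappable_trans:
  assumes ab: "swappable a b" and bc: "swappable b c" and ac: "a \<noteq> c"
  shows "swappable a c"
proof -
  have *: False if ab: "swappable a b" and bc: "swappable b c" and const: "\<And>x. x \<in> topspace X \<Longrightarrow> r x a c" for a b c
  proof -
    have o1: "occurs b a c" using ab const by (auto simp: occurs_def swappable_def ordered3_def)
    have o2: "occurs a c b" using bc const by (auto simp: occurs_def swappable_def ordered3_def)
    obtain g where g: "g \<in> G" "g b = a" "g a = c" "g c = b" using occurs_iso[OF o1 o2] by auto
    then have "occurs c b a" using occurs_act[OF g(1) o2] by simp
    then obtain x where "x \<in> topspace X" "r x c b" "r x b a" by (auto simp: occurs_def ordered3_def)
    then show False using const[of x] r_trans[of x c b a] r_asym[of x a c] by blast
  qed
  obtain x where x: "x \<in> topspace X" using nonempty by blast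
  show ?thesis
    using *[OF ab bc] *[OF swappable_sym[OF bc] swappable_sym[OF ab]] r_total[OF x ac] not_swappable_const[of a c x] not_swappable_const[of c a x] x
      swappable_sym by blast
qed

lemma between_cases:
  assumes "x \<in> topspace X" "u \<noteq> v" "v \<noteq> w" "u \<noteq> w"
  shows "between x u v w \<or> between x u w v \<or> between x v u w"
  using r_total[OF assms(1)] assms(2-) unfolding between_def ordered3_def by blast

end

text \<open>Reversing all orders is a symmetry of the setting, so statements about elements above
  follow from those about elements below.\<close>

lemma measured_flow_converse:
  assumes "measured_flow G X act r \<mu>" shows "measured_flow G X act (\<lambda>x i j. r x j i) \<mu>"
proof -
  interpret measured_flow G X act r \<mu> by fact
  show ?thesis
  proof unfold_locales
    show "strict_linear (\<lambda>(i, j). r x j i)" if "x \<in> topspace X" for x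
      using r_linear[OF that] by (auto simp: strict_linear_def)
  qed (auto simp: open_r r_act inv_prob)
qed

section \<open>Probabilities of the orders of a triple\<close>

context measured_flow
begin

definition pr :: "('a \<Rightarrow> bool) \<Rightarrow> real" where
  "pr P = measure \<mu> {x\<in>space \<mu>. P x}"

lemma ordered3_measurable [measurable]: "Measurable.pred \<mu> (\<lambda>x. ordered3 x u v w)"
  unfolding ordered3_def by measurable

lemma between_measurable [measurable]: "Measurable.pred \<mu> (\<lambda>x. between x u v w)"
  unfolding between_def by measurable

lemma pred_sets: "Measurable.pred \<mu> P \<Longrightarrow> {x\<in>topspace X. P x} \<in> sets \<mu>"
  by (simp add: pred_def space_mu)

lemma pr_cong: "(\<And>x. x \<in> topspace X \<Longrightarrow> P x = Q x) \<Longrightarrow> pr P = pr Q"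
  unfolding pr_def by (rule arg_cong[where f="measure \<mu>"]) (auto simp: space_mu)

lemma pr_mono:
  assumes m: "Measurable.pred \<mu> Q" and "\<And>x. x \<in> topspace X \<Longrightarrow> P x \<Longrightarrow> Q x"
  shows "pr P \<le> pr Q"
  unfolding pr_def by (rule finite_measure_mono) (use assms pred_sets[OF m] in \<open>auto simp: space_mu\<close>)

lemma pr_disj:
  assumes m: "Measurable.pred \<mu> P" "Measurable.pred \<mu> Q"
    and "\<And>x. x \<in> topspace X \<Longrightarrow> P x \<Longrightarrow> \<not> Q x"
  shows "pr (\<lambda>x. P x \<or> Q x) = pr P + pr Q"
proof -
  have "{x\<in>space \<mu>. P x \<or> Q x} = {x\<in>space \<mu>. P x} \<union> {x\<in>space \<mu>. Q x}" by auto
  then show ?thesis unfolding pr_def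
    using assms(3) m[THEN pred_sets] by (simp add: space_mu) (subst finite_measure_Union, auto)
qed

lemma pr_not:
  assumes [measurable]: "Measurable.pred \<mu> P" shows "pr (\<lambda>x. \<not> P x) = 1 - pr P"
  unfolding pr_def by (rule prob_neg) simp

lemma pr_inv:
  assumes g: "g \<in> G" and P: "Measurable.pred \<mu> P"
  shows "pr (\<lambda>x. P (act g x)) = pr P"
proof -
  have "{x\<in>space \<mu>. P x} \<in> sets \<mu>" using P by (simp add: pred_def)
  from measure_act[OF g this] show ?thesis
    unfolding pr_def by (simp add: space_mu act_in[OF g] cong: conj_cong)
qed

lemma pr_pos:
  assumes x: "x \<in> topspace X" and P: "Measurable.pred \<mu> P" and D: "finite D"
    and "\<And>y. y \<in> topspace X \<Longrightarrow> agree D x y \<Longrightarrow> P y"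
  shows "pr P > 0"
proof -
  have "measure \<mu> (cyl D x) \<le> pr P"
    unfolding pr_def by (rule finite_measure_mono) (use assms pred_sets[OF P] in \<open>auto simp: cyl_def space_mu\<close>)
  then show ?thesis using measure_cyl_pos[OF D x] by simp
qed

definition prob3 :: "nat \<Rightarrow> nat \<Rightarrow> nat \<Rightarrow> real" where
  "prob3 u v w = pr (\<lambda>x. ordered3 x u v w)"

lemma prob3_act: assumes "g \<in> G" shows "prob3 (g u) (g v) (g w) = prob3 u v w"
proof -
  have "prob3 (g u) (g v) (g w) = pr (\<lambda>x. ordered3 (act g x) (g u) (g v) (g w))"
    unfolding prob3_def by (rule pr_inv[OF assms, symmetric]) measurable
  also have "\<dots> = prob3 u v w" unfolding prob3_def by (rule pr_cong) (simp add: ordered3_act assms)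
  finally show ?thesis .
qed

lemma prob3_pos: assumes "occurs u v w" shows "prob3 u v w > 0"
proof -
  obtain x where x: "x \<in> topspace X" "ordered3 x u v w" using assms by (auto simp: occurs_def)
  show ?thesis unfolding prob3_def
    by (rule pr_pos[OF x(1), of _ "{u, v, w}"]) (use x(2) in \<open>auto simp: ordered3_def agree_def\<close>)
qed

lemma prob3_zero: assumes "\<not> occurs u v w" shows "prob3 u v w = 0"
proof -
  have "prob3 u v w = pr (\<lambda>x. False)" unfolding prob3_def by (rule pr_cong) (use assms in \<open>auto simp: occurs_def\<close>)
  then show ?thesis by (simp add: pr_def)
qed

lemma prob3_eq: "occurs u v w \<Longrightarrow> occurs a b c \<Longrightarrow> {u, v, w} = {a, b, c} \<Longrightarrow> prob3 u v w = prob3 a b c"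
  using occurs_iso[of u v w a b c] prob3_act by metis

text \<open>A group element that exchanges \<open>u\<close> and \<open>v\<close> preserves the
  measure and interchanges two complementary events.\<close>

lemma swappable_half: assumes "swappable u v" shows "pr (\<lambda>x. r x u v) = 1 / 2"
proof -
  obtain g where g: "g \<in> G" "g u = v" "g v = u" using swappable_swap[OF assms] by blast
  have "pr (\<lambda>x. r x v u) = pr (\<lambda>x. r (act g x) v u)" by (rule pr_inv[OF g(1), symmetric]) measurable
  also have "\<dots> = pr (\<lambda>x. r x u v)" by (rule pr_cong) (metis g r_act)
  finally have "pr (\<lambda>x. r x v u) = pr (\<lambda>x. r x u v)" .
  moreover have "pr (\<lambda>x. r x v u) = pr (\<lambda>x. \<not> r x u v)"
    by (rule pr_cong) (use not_r_iff swappable_neq[OF assms] in auto)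
  ultimately show ?thesis using pr_not[of "\<lambda>x. r x u v"] by simp
qed

lemma pr_pair_split:
  assumes "u \<noteq> v" "w \<noteq> u" "w \<noteq> v"
  shows "pr (\<lambda>x. r x u v) = prob3 w u v + prob3 u w v + prob3 u v w"
proof -
  have "pr (\<lambda>x. r x u v) = pr (\<lambda>x. (ordered3 x w u v \<or> ordered3 x u w v) \<or> ordered3 x u v w)"
    by (rule pr_cong) (use r_total r_trans assms in \<open>unfold ordered3_def, blast\<close>)
  also have "\<dots> = pr (\<lambda>x. ordered3 x w u v \<or> ordered3 x u w v) + prob3 u v w"
    unfolding prob3_def by (rule pr_disj) (measurable, use r_trans r_asym in \<open>unfold ordered3_def, blast\<close>)
  also have "pr (\<lambda>x. ordered3 x w u v \<or> ordered3 x u w v) = prob3 w u v + prob3 u w v"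
    unfolding prob3_def by (rule pr_disj) (measurable, use r_trans r_asym in \<open>unfold ordered3_def, blast\<close>)
  finally show ?thesis .
qed

text \<open>The events \<open>v\<close> before \<open>w\<close> and \<open>v\<close> before
  \<open>u\<close> both have probability 1/2 and share the two orders that begin with
  \<open>v\<close>. What remains is \<open>u, v, w\<close> in the first and \<open>w, v, u\<close>
  in the second.\<close>

lemma prob3_rev:
  assumes "swappable u v" "swappable v w" "swappable u w"
  shows "prob3 u v w = prob3 w v u"
proof -
  have n: "u \<noteq> v" "v \<noteq> w" "u \<noteq> w" using assms swappable_neq by auto
  have "prob3 w u v + prob3 u w v + prob3 u v w = 1 / 2"
    using pr_pair_split[of u v w] swappable_half[OF assms(1)] n by simp
  moreover have "prob3 v u w + prob3 u v w + prob3 u w v = 1 / 2"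
    using pr_pair_split[of u w v] swappable_half[OF assms(3)] n by simp
  moreover have "prob3 u v w + prob3 v u w + prob3 v w u = 1 / 2"
    using pr_pair_split[of v w u] swappable_half[OF assms(2)] n by simp
  moreover have "prob3 w v u + prob3 v w u + prob3 v u w = 1 / 2"
    using pr_pair_split[of v u w] swappable_half[OF swappable_sym[OF assms(1)]] n by simp
  ultimately show ?thesis by linarith
qed

text \<open>The measure settles a combinatorial question: an order occurs exactly if its probability
  is positive.\<close>

lemma occurs_rev:
  assumes "swappable u v" "swappable v w" "swappable u w" "occurs u v w"
  shows "occurs w v u"
  using prob3_rev[OF assms(1-3)] prob3_pos[OF assms(4)] prob3_zero[of w v u] by fastforce

text \<open>The element that reverses \<open>u, v, w\<close> exchanges \<open>u\<close> and
  \<open>w\<close> and fixes \<open>v\<close>. It turns an order with middle \<open>w\<close> into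
  one with middle \<open>u\<close>, so all three middles occur; reversal supplies the rest.\<close>

lemma all_orders_if_two_middles:
  assumes swappable: "swappable u v" "swappable v w" "swappable u w" and occurs: "occurs u v w" "occurs u w v"
  shows "all_orders u v w"
proof -
  note swappable' = swappable swappable[THEN swappable_sym]
  have 1: "occurs w v u" and 2: "occurs v w u" using occurs_rev swappable' occurs by blast+
  obtain g where g: "g \<in> G" "g u = w" "g v = v" "g w = u" using occurs_iso[OF occurs(1) 1] by auto
  then have 3: "occurs w u v" using occurs_act[OF g(1) occurs(2)] by simp
  then have "occurs v u w" using occurs_rev swappable' by blast
  then show ?thesis using 1 2 3 occurs by (simp add: all_orders_def)
qed

text \<open>Orders occur together with their reverses, so only the set of possible middles matters:
  two middles force all three, and a single one is a constant betweenness.\<close>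

lemma all_orders_cases:
  assumes swappable: "swappable u v" "swappable v w" "swappable u w"
  shows "all_orders u v w \<or> (\<forall>x\<in>topspace X. between x u v w) \<or> (\<forall>x\<in>topspace X. between x u w v) \<or>
    (\<forall>x\<in>topspace X. between x v u w)"
proof -
  note swappable' = swappable swappable[THEN swappable_sym]
  have n: "u \<noteq> v" "v \<noteq> w" "u \<noteq> w" using swappable swappable_neq by auto
  have perm: "all_orders a b c \<Longrightarrow> all_orders u v w" if "(a, b, c) \<in> {(u,v,w), (u,w,v), (v,u,w), (v,w,u), (w,u,v), (w,v,u)}" for a b c
    using that by (auto simp: all_orders_def)
  have A: "occurs u v w" if "x \<in> topspace X" "between x u v w" for x
    using that occurs_rev[of w v u] swappable' unfolding between_def occurs_def by blast
  have B: "occurs u w v" if "x \<in> topspace X" "between x u w v" for x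
    using that occurs_rev[of v w u] swappable' unfolding between_def occurs_def by blast
  have C: "occurs v u w" if "x \<in> topspace X" "between x v u w" for x
    using that occurs_rev[of w u v] swappable' unfolding between_def occurs_def by blast
  have C': "occurs w u v" if "x \<in> topspace X" "between x v u w" for x
    using C[OF that] occurs_rev[of v u w] swappable' by blast
  have AB: "all_orders u v w" if "occurs u v w" "occurs u w v" using all_orders_if_two_middles swappable that by blast
  have AC: "all_orders u v w" if "occurs w v u" "occurs w u v"
    using all_orders_if_two_middles[of w v u] swappable' that perm[of w v u] by blast
  have BC: "all_orders u v w" if "occurs v w u" "occurs v u w"
    using all_orders_if_two_middles[of v w u] swappable' that perm[of v w u] by blast
  show ?thesis
    using between_cases[OF _ n] A B C C' AB AC BC occurs_rev[of u v w] occurs_rev[of u w v] swappable' by blast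
qed

text \<open>The orders of the triple are equally likely as they all occur. The event
  \<open>u\<close> before \<open>v\<close>, of probability 1/2, consists of three of them.\<close>

lemma all_orders_q:
  assumes swappable: "swappable u v" "swappable v w" "swappable u w" and all_orders: "all_orders u v w"
  shows "prob3 u v w = 1 / 6"
proof -
  have n: "u \<noteq> v" "v \<noteq> w" "u \<noteq> w" using swappable swappable_neq by auto
  have "prob3 w u v + prob3 u w v + prob3 u v w = 1 / 2"
    using pr_pair_split[of u v w] swappable_half[OF swappable(1)] n by simp
  moreover have "prob3 w u v = prob3 u v w" "prob3 u w v = prob3 u v w"
    using all_orders by (auto simp: all_orders_def intro!: prob3_eq)
  ultimately show ?thesis by simp
qed

lemma all_orders_perms: "all_orders u v w \<Longrightarrow> all_orders u w v" "all_orders u v w \<Longrightarrow> all_orders v u w" "all_orders u v w \<Longrightarrow> all_orders v w u"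
  "all_orders u v w \<Longrightarrow> all_orders w u v" "all_orders u v w \<Longrightarrow> all_orders w v u"
  by (auto simp: all_orders_def)

lemma all_orders_act: "g \<in> G \<Longrightarrow> all_orders u v w \<Longrightarrow> all_orders (g u) (g v) (g w)"
  using occurs_act by (simp add: all_orders_def)

lemma pr_between: assumes "u \<noteq> w" shows "pr (\<lambda>x. between x u v w) = prob3 u v w + prob3 w v u"
  unfolding between_def prob3_def by (rule pr_disj) (measurable, use r_trans r_asym in \<open>unfold ordered3_def, blast\<close>)

lemma pr_between_all_orders:
  assumes swappable: "swappable u v" "swappable v w" "swappable u w" and all_orders: "all_orders u v w"
  shows "pr (\<lambda>x. between x u v w) = 1 / 3"
  using all_orders_q[OF swappable all_orders] all_orders_q[of w v u] swappable[THEN swappable_sym] all_orders_perms[OF all_orders] pr_between[of u w v] swappable_neq[OF swappable(3)] by simp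

text \<open>A middle is either constant or accounts for two of six equally likely orders. The gaps
  between these values exclude mixed configurations of four points.\<close>

lemma pr_between_values:
  assumes swappable: "swappable u v" "swappable v w" "swappable u w"
  shows "pr (\<lambda>x. between x u v w) \<in> {0, 1 / 3, 1}"
proof -
  have n: "u \<noteq> v" "v \<noteq> w" "u \<noteq> w" using swappable swappable_neq by auto
  have true: "pr (\<lambda>x. True) = 1" and false: "pr (\<lambda>x. False) = 0" using prob_space by (simp_all add: pr_def)
  have ex: "\<not> between x u v w" if "x \<in> topspace X" "between x u w v \<or> between x v u w" for x
    using that r_asym r_trans unfolding between_def ordered3_def by blast
  consider "all_orders u v w" | "\<forall>x\<in>topspace X. between x u v w" | "\<forall>x\<in>topspace X. \<not> between x u v w"
    using all_orders_cases[OF swappable] ex by blast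
  then show ?thesis
  proof cases
    case 1
    then show ?thesis using pr_between_all_orders[OF swappable] by simp
  next
    case 2
    then have "pr (\<lambda>x. between x u v w) = pr (\<lambda>x. True)" by (intro pr_cong) auto
    then show ?thesis using true by simp
  next
    case 3
    then have "pr (\<lambda>x. between x u v w) = pr (\<lambda>x. False)" by (intro pr_cong) auto
    then show ?thesis using false by simp
  qed
qed

text \<open>A constant middle of a, b, d would force a betweenness probability other than 0, 1/3 and 1.\<close>
lemma all_orders_extend:
  assumes swappable: "swappable a c" "swappable a b" "swappable a d" "swappable c b" "swappable c d" "swappable b d" and all_orders: "all_orders a c b"
  shows "all_orders a b d"
proof (rule ccontr)
  assume no: "\<not> all_orders a b d"
  note swappable' = swappable swappable[THEN swappable_sym]
  have n: "a \<noteq> c" "a \<noteq> b" "a \<noteq> d" "c \<noteq> b" "c \<noteq> d" "b \<noteq> d" using swappable swappable_neq by auto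
  \<comment> \<open>With \<open>a\<close> always between \<open>b\<close> and \<open>d\<close>, the
    point \<open>c\<close> lies on exactly one side of \<open>a\<close>. So \<open>a\<close> is
    between \<open>c\<close> and \<open>d\<close> with probability 1 - 1/3 = 2/3, which is not an
    admissible value.\<close>
  have mid_end: False
    if swab: "swappable a c" "swappable a b" "swappable a d" "swappable c b" "swappable c d" "swappable b d" and all_orders: "all_orders a c b"
      and const: "\<forall>x\<in>topspace X. between x b a d" for a b
  proof -
    note s = swab swab[THEN swappable_sym]
    have "between x c a d \<longleftrightarrow> \<not> between x c a b" if x: "x \<in> topspace X" for x
    proof -
      have "between x b a d" using const x by blast
      then show ?thesis using r_total[OF x, of a c] r_asym[OF x] swappable_neq[OF swab(1)]
        unfolding between_def ordered3_def by blast
    qed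
    then have "pr (\<lambda>x. between x c a d) = pr (\<lambda>x. \<not> between x c a b)" by (rule pr_cong)
    also have "\<dots> = 1 - pr (\<lambda>x. between x c a b)" by (rule pr_not) measurable
    also have "pr (\<lambda>x. between x c a b) = 1 / 3" using pr_between_all_orders[of c a b] s all_orders_perms[OF all_orders] by blast
    finally show False using pr_between_values[of c a d] s by auto
  qed
  consider "\<forall>x\<in>topspace X. between x b a d" | "\<forall>x\<in>topspace X. between x a b d" | "\<forall>x\<in>topspace X. between x a d b"
    using all_orders_cases[of a b d] swappable' no by blast
  then show False
  proof cases
    case 1
    then show False using mid_end[of a b] swappable all_orders by blast
  next
    case 2
    then show False using mid_end[of b a] swappable' all_orders_perms[OF all_orders] by blast
  next
    \<comment> \<open>With \<open>d\<close> always between \<open>a\<close> and \<open>b\<close>,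
      exactly one of the pairs \<open>a, c\<close> and \<open>b, c\<close> encloses
      \<open>d\<close>. The two probabilities add up to 1 and each is at least 1/3, which the
      admissible values do not allow.\<close>
    case 3
    have ex: "between x a d c \<longleftrightarrow> \<not> between x b d c" if x: "x \<in> topspace X" for x
    proof -
      have "between x a d b" using 3 x by blast
      then show ?thesis using r_total[OF x, of c d] r_asym[OF x] n
        unfolding between_def ordered3_def by blast
    qed
    have "pr (\<lambda>x. between x a d c) = pr (\<lambda>x. \<not> between x b d c)" using ex by (rule pr_cong)
    also have "\<dots> = 1 - pr (\<lambda>x. between x b d c)" by (rule pr_not) measurable
    finally have sum: "pr (\<lambda>x. between x a d c) + pr (\<lambda>x. between x b d c) = 1" by simp
    have "between x a d c" if "x \<in> topspace X" "between x a b c" for x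
      using 3 that r_trans[OF that(1)] r_asym[OF that(1)] unfolding between_def ordered3_def by blast
    then have "pr (\<lambda>x. between x a b c) \<le> pr (\<lambda>x. between x a d c)" by (intro pr_mono between_measurable) auto
    moreover have "between x b d c" if "x \<in> topspace X" "between x b a c" for x
      using 3 that r_trans[OF that(1)] r_asym[OF that(1)] unfolding between_def ordered3_def by blast
    then have "pr (\<lambda>x. between x b a c) \<le> pr (\<lambda>x. between x b d c)" by (intro pr_mono between_measurable) auto
    moreover have "pr (\<lambda>x. between x a b c) = 1 / 3" "pr (\<lambda>x. between x b a c) = 1 / 3"
      using pr_between_all_orders[of a b c] pr_between_all_orders[of b a c] swappable' all_orders_perms[OF all_orders] by blast+
    ultimately show False
      using sum pr_between_values[of a d c] pr_between_values[of b d c] swappable' by auto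
  qed
qed

text \<open>Fatou argument without independence: the limsup of events of probability at least
  \<open>\<delta>\<close> has probability at least \<open>\<delta>\<close>, so it meets every almost
  sure event.\<close>

lemma exists_infinitely_often:
  assumes F[measurable]: "\<And>k. Measurable.pred \<mu> (F k)" and \<delta>: "\<delta> > 0" "\<And>k::nat. pr (F k) \<ge> \<delta>"
    and Q: "AE x in \<mu>. Q x"
  shows "\<exists>x\<in>topspace X. Q x \<and> infinite {k. F k x}"
proof (rule ccontr)
  assume con: "\<not> ?thesis"
  define H where "H n = {x\<in>space \<mu>. \<exists>k\<ge>n. F k x}" for n
  have Hm: "H n \<in> sets \<mu>" for n unfolding H_def by measurable
  have "(\<lambda>n. measure \<mu> (H n)) \<longlonglongrightarrow> measure \<mu> (\<Inter>n. H n)"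
    by (rule finite_Lim_measure_decseq) (use Hm in \<open>auto simp: decseq_def H_def intro: order_trans\<close>)
  moreover have "measure \<mu> (H n) \<ge> \<delta>" for n
  proof -
    have "pr (F n) \<le> measure \<mu> (H n)"
      unfolding pr_def by (rule finite_measure_mono) (use Hm in \<open>auto simp: H_def\<close>)
    then show ?thesis using \<delta>(2)[of n] by simp
  qed
  ultimately have ge: "measure \<mu> (\<Inter>n. H n) \<ge> \<delta>" by (intro LIMSEQ_le_const) auto
  have "AE x in \<mu>. x \<notin> (\<Inter>n. H n)"
  proof (rule AE_mp[OF Q], rule AE_I2, rule impI)
    fix x assume x: "x \<in> space \<mu>" "Q x"
    then have "finite {k. F k x}" using con space_mu by auto
    then obtain m where "\<forall>k\<in>{k. F k x}. k < m" using finite_nat_set_iff_bounded by auto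
    then have "x \<notin> H m" by (auto simp: H_def)
    then show "x \<notin> (\<Inter>n. H n)" by blast
  qed
  moreover have "(\<Inter>n. H n) \<in> sets \<mu>" using Hm by auto
  ultimately have "measure \<mu> (\<Inter>n. H n) = 0" using prob_eq_0 by blast
  then show False using ge \<delta>(1) by simp
qed

end

subsection \<open>Exchangeable sequences\<close>

lemma sorted_list_of_strict_mono_image:
  fixes s :: "nat \<Rightarrow> nat"
  assumes "strict_mono_on {..<N} s"
  shows "sorted_list_of_set (s ` {..<N}) = map s [0..<N]"
proof -
  have "sorted_wrt (<) (map s [0..<N])"
    using assms by (simp add: sorted_wrt_iff_nth_less strict_mono_on_def)
  moreover have "set (map s [0..<N]) = s ` {..<N}" by (auto simp: atLeast0LessThan)
  ultimately show ?thesis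
    using sorted_list_of_set.idem_if_sorted_distinct[of "map s [0..<N]"] strict_sorted_iff by metis
qed

context measured_flow
begin

text \<open>The order type of \<open>Z\<close> together with the values of \<open>s\<close>, written
  on names: \<open>Inl\<close> for elements of \<open>Z\<close>, \<open>Inr k\<close> for
  \<open>s k\<close>. This makes different sequences comparable.\<close>

definition pattern :: "nat set \<Rightarrow> nat \<Rightarrow> (nat \<Rightarrow> nat) \<Rightarrow> 'a \<Rightarrow> ((nat + nat) \<times> (nat + nat)) set" where
  "pattern Z N s x = {(u, v). u \<in> Z <+> {..<N} \<and> v \<in> Z <+> {..<N} \<and> r x (case_sum id s u) (case_sum id s v)}"

text \<open>A set of size \<open>N\<close> is coloured by all patterns that the points of
  \<open>X\<close> produce on its increasing enumeration. Recording all of them, not the pattern at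
  one point, lets a pattern seen on one enumeration be realised on another, at a different
  point.\<close>

lemma pattern_homogeneous_subset:
  assumes Z: "finite Z" and S: "infinite S"
  shows "\<exists>S'\<subseteq>S. infinite S' \<and> (\<forall>s t. strict_mono_on {..<N} s \<longrightarrow> strict_mono_on {..<N} t \<longrightarrow>
    s ` {..<N} \<subseteq> S' \<longrightarrow> t ` {..<N} \<subseteq> S' \<longrightarrow>
    pattern Z N s ` topspace X = pattern Z N t ` topspace X)"
proof -
  let ?C = "Z <+> {..<N}"
  let ?PP = "Pow (Pow (?C \<times> ?C))"
  have "finite ?PP" using Z by simp
  from finite_imp_inj_to_nat_seg[OF this]
  \<comment> \<open>The Ramsey theorem takes numbers below a bound as colours, so the finitely many
    sets of patterns are numbered.\<close>
  obtain e and M :: nat where e: "e ` ?PP = {i. i < M}" "inj_on e ?PP" by (elim exE conjE)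
  define pats where "pats s = pattern Z N s ` topspace X" for s
  have pats: "pats s \<in> ?PP" for s by (auto simp: pats_def pattern_def)
  define f where "f I = e (pats (\<lambda>k. sorted_list_of_set I ! k))" for I
  have "f I < M" for I using e(1) pats unfolding f_def by blast
  then have "\<forall>I. I \<subseteq> S \<and> finite I \<and> card I = N \<longrightarrow> f I < M" by blast
  from Ramsey[OF S this] obtain S' t where S': "S' \<subseteq> S" "infinite S'"
    and hom: "\<forall>I. I \<subseteq> S' \<and> finite I \<and> card I = N \<longrightarrow> f I = t"
    by (elim exE conjE)
  have f_image: "f (s ` {..<N}) = e (pats s)" if "strict_mono_on {..<N} s" for s
  proof -
    have "pattern Z N (\<lambda>k. sorted_list_of_set (s ` {..<N}) ! k) = pattern Z N s"
      using sorted_list_of_strict_mono_image[OF that] by (auto simp: pattern_def fun_eq_iff)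
    then show ?thesis by (simp add: f_def pats_def)
  qed
  have "pats s = pats s'"
    if s: "strict_mono_on {..<N} s" "s ` {..<N} \<subseteq> S'" "strict_mono_on {..<N} s'" "s' ` {..<N} \<subseteq> S'" for s s'
  proof -
    have "card (s ` {..<N}) = N" "card (s' ` {..<N}) = N"
      using s by (simp_all add: card_image[OF strict_mono_on_imp_inj_on])
    then have "f (s ` {..<N}) = t" "f (s' ` {..<N}) = t" using hom s by simp_all
    then have "e (pats s) = e (pats s')" unfolding f_image[OF s(1)] f_image[OF s(3)] by (rule trans[OF _ sym])
    then show ?thesis by (rule inj_onD[OF e(2) _ pats pats])
  qed
  then show ?thesis using S' unfolding pats_def by (intro exI[of _ S'] conjI allI impI)
qed

text \<open>Choose \<open>p\<^sub>0 < q\<^sub>0 < p\<^sub>1 < q\<^sub>1 < \<dots>\<close> alternately from \<open>P\<close> and \<open>Q\<close>. By homogeneity, replacing \<open>p\<^sub>i\<close> by \<open>q\<^sub>i\<close>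
  yields an order on the same set whose maximum is \<open>p\<^sub>i\<close> instead of \<open>z\<close>.\<close>
lemma exchange_family:
  assumes W: "\<And>w w'. w \<in> W \<Longrightarrow> w' \<in> W \<Longrightarrow> w = w'" and S: "infinite S"
    and hyp: "\<And>S'. S' \<subseteq> S \<Longrightarrow> infinite S' \<Longrightarrow> \<exists>x\<in>topspace X. \<exists>P Q. P \<subseteq> S' \<and> Q \<subseteq> S' \<and> infinite P \<and> infinite Q \<and>
       (\<forall>w\<in>W. r x w z) \<and> (\<forall>w\<in>W. \<forall>p\<in>P. r x w p) \<and> (\<forall>p\<in>P. r x p z) \<and> (\<forall>q\<in>Q. r x z q)"
  shows "\<exists>B\<subseteq>S. finite B \<and> card B = N \<and>
    (\<forall>b\<in>B. \<exists>g\<in>G. g ` (W \<union> {z} \<union> B) = W \<union> {z} \<union> B \<and> (\<forall>w\<in>W. g w = w) \<and> g z = b)"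
proof -
  \<comment> \<open>\<open>W\<close> holds the left end point of the interval, or is empty for an
    interval unbounded below.\<close>
  have finW: "finite W"
  proof (cases "W = {}")
    case False
    then obtain w where "W = {w}" using W by blast
    then show ?thesis by simp
  qed simp
  let ?Z = "insert z W"
  have finZ: "finite ?Z" using finW by simp
  obtain S' where S': "S' \<subseteq> S" "infinite S'" and hom: "\<forall>s t. strict_mono_on {..<N} s \<longrightarrow> strict_mono_on {..<N} t \<longrightarrow>
    s ` {..<N} \<subseteq> S' \<longrightarrow> t ` {..<N} \<subseteq> S' \<longrightarrow>
    pattern ?Z N s ` topspace X = pattern ?Z N t ` topspace X"
    using pattern_homogeneous_subset[OF finZ S, of N] by (elim exE conjE)
  obtain x P Q where x: "x \<in> topspace X" and P: "P \<subseteq> S'" "infinite P" and Q: "Q \<subseteq> S'" "infinite Q"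
    and Wz: "\<And>w. w \<in> W \<Longrightarrow> r x w z" and WP: "\<And>w p. w \<in> W \<Longrightarrow> p \<in> P \<Longrightarrow> r x w p"
    and Pz: "\<And>p. p \<in> P \<Longrightarrow> r x p z" and zQ: "\<And>q. q \<in> Q \<Longrightarrow> r x z q"
    using hyp[OF S'] by metis
  have "\<exists>f. \<forall>n. (f n \<in> (if even n then P else Q)) \<and> f n < f (Suc n)"
  proof (rule dependent_nat_choice)
    show "\<exists>a. a \<in> (if even (0::nat) then P else Q)" using P(2) infinite_imp_nonempty by auto
    show "\<exists>b. b \<in> (if even (Suc n) then P else Q) \<and> a < b" for a n
      using P(2) Q(2) unfolding infinite_nat_iff_unbounded by auto
  qed
  then obtain f where f: "\<And>n. f n \<in> (if even n then P else Q)" "\<And>n. f n < f (Suc n)" by blast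
  have sm: "strict_mono f" using f(2) by (simp add: strict_mono_Suc_iff)
  define p where "p k = f (2 * k)" for k
  have pP: "p k \<in> P" for k using f(1)[of "2 * k"] by (simp add: p_def)
  have smp: "strict_mono p" using sm by (auto simp: strict_mono_def p_def)
  define B where "B = p ` {..<N}"
  let ?D = "W \<union> {z} \<union> B"
  have BS: "B \<subseteq> S'" using pP P(1) by (auto simp: B_def)
  have finD: "finite ?D" using finW by (simp add: B_def)
  have "\<exists>g\<in>G. g ` ?D = ?D \<and> (\<forall>w\<in>W. g w = w) \<and> g z = p i" if i: "i < N" for i
  proof -
    \<comment> \<open>As numbers, \<open>f (2 * i + 1)\<close> lies strictly between
      \<open>p i\<close> and \<open>p (Suc i)\<close>, so the modified sequence is still increasing
      and homogeneity applies to it.\<close>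
    define s where "s k = (if k = i then f (2 * i + 1) else p k)" for k
    have qQ: "s i \<in> Q" using f(1)[of "2 * i + 1"] by (simp add: s_def)
    have "s k < s l" if "k < l" for k l
      using that sm by (auto simp: s_def p_def strict_mono_def)
    then have "strict_mono_on {..<N} s" by (simp add: strict_mono_on_def)
    moreover have "strict_mono_on {..<N} p" using smp by (simp add: strict_mono_on_def strict_mono_def)
    moreover have "s ` {..<N} \<subseteq> S'" using qQ pP P(1) Q(1) by (auto simp: s_def)
    ultimately have "pattern ?Z N s x \<in> pattern ?Z N p ` topspace X"
      using hom[rule_format, of s p] BS x unfolding B_def by blast
    then obtain y where y: "y \<in> topspace X" and pat: "pattern ?Z N p y = pattern ?Z N s x" by auto
    have tr: "r y (case_sum id p u) (case_sum id p v) = r x (case_sum id s u) (case_sum id s v)"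
      if "u \<in> ?Z <+> {..<N}" "v \<in> ?Z <+> {..<N}" for u v
      using arg_cong[OF pat, of "\<lambda>S. (u, v) \<in> S"] that unfolding pattern_def by blast
    have yWz: "r y w z" if "w \<in> W" for w using tr[of "Inl w" "Inl z"] that Wz by auto
    have yWp: "r y w (p k)" if "w \<in> W" "k < N" for w k
    proof -
      have "r x w (s k)"
        using that WP pP r_trans[OF x Wz[OF that(1)] zQ[OF qQ]] by (cases "k = i") (auto simp: s_def)
      then show ?thesis using tr[of "Inl w" "Inr k"] that by auto
    qed
    have yzi: "r y z (p i)" using tr[of "Inl z" "Inr i"] i zQ[OF qQ] by auto
    have ypz: "r y (p k) z" if "k < N" "k \<noteq> i" for k
      using tr[of "Inr k" "Inl z"] that Pz pP by (auto simp: s_def)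
    have ymax: "u = p i \<or> r y u (p i)" if "u \<in> ?D" for u
      using that yzi ypz yWz r_trans[OF y _ yzi] by (auto simp: B_def)
    have xmax: "u = z \<or> r x u z" if "u \<in> ?D" for u
      using that Wz Pz pP by (auto simp: B_def)
    have xmin: "u = w \<or> r x w u" if "u \<in> ?D" "w \<in> W" for u w
      using that W Wz WP pP by (auto simp: B_def)
    have ymin: "u = w \<or> r y w u" if "u \<in> ?D" "w \<in> W" for u w
      using that W yWz yWp by (auto simp: B_def)
    obtain g where g: "g \<in> setstab ?D" "agree ?D (act g x) y"
      using setstab_agree[OF finD x y] by blast
    have gG: "g \<in> G" and gD: "g ` ?D = ?D" using g(1) by (auto simp: setstab_def)
    have mono: "r y (g u) (g v)" if "u \<in> ?D" "v \<in> ?D" "r x u v" for u v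
      using that g(2) gD r_act[OF gG x, of u v] unfolding agree_def by blast
    \<comment> \<open>On \<open>?D\<close>, \<open>g\<close> is an isomorphism from the order of
      \<open>x\<close> to that of \<open>y\<close>. It takes maximum to maximum, here
      \<open>z\<close> to \<open>p i\<close>, and below it fixes the common minimum in
      \<open>W\<close>.\<close>
    have "g z = p i"
    proof -
      have "p i \<in> g ` ?D" unfolding gD using i by (auto simp: B_def)
      then obtain u where u: "u \<in> ?D" "p i = g u" by blast
      have "g z \<in> ?D" using gD by blast
      then show ?thesis
        using xmax[OF u(1)] mono[OF u(1), of z] ymax[of "g z"] u(2) r_asym[OF y] by auto
    qed
    moreover have "g w = w" if w: "w \<in> W" for w
    proof -
      have "w \<in> g ` ?D" unfolding gD using w by auto
      then obtain u where u: "u \<in> ?D" "w = g u" by blast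
      have "g w \<in> ?D" using gD w by blast
      then show ?thesis
        using xmin[OF u(1) w] mono[OF _ u(1), of w] ymin[of "g w" w] u(2) w r_asym[OF y] by auto
    qed
    ultimately show ?thesis using gG gD by blast
  qed
  moreover have "card B = N"
    using smp by (simp add: B_def card_image strict_mono_imp_inj_on inj_on_def strict_mono_eq)
  moreover have "B \<subseteq> S" "finite B" using BS S' by (auto simp: B_def)
  ultimately show ?thesis by (intro exI[of _ B]) (auto simp: B_def)
qed

text \<open>The events that \<open>v\<close> is the least element of \<open>B \<union> {z}\<close> above \<open>W\<close> are disjoint, and by the
  previous lemma equally likely.\<close>
lemma exists_below_above_AE:
  assumes W: "\<And>w w'. w \<in> W \<Longrightarrow> w' \<in> W \<Longrightarrow> w = w'" and S: "infinite S"
    and zW: "z \<notin> W" and SZ: "S \<inter> insert z W = {}"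
    and hyp: "\<And>S'. S' \<subseteq> S \<Longrightarrow> infinite S' \<Longrightarrow> \<exists>x\<in>topspace X. \<exists>P Q. P \<subseteq> S' \<and> Q \<subseteq> S' \<and> infinite P \<and> infinite Q \<and>
       (\<forall>w\<in>W. r x w z) \<and> (\<forall>w\<in>W. \<forall>p\<in>P. r x w p) \<and> (\<forall>p\<in>P. r x p z) \<and> (\<forall>q\<in>Q. r x z q)"
  shows "AE x in \<mu>. (\<forall>w\<in>W. r x w z) \<longrightarrow> (\<exists>b\<in>S. (\<forall>w\<in>W. r x w b) \<and> r x b z)"
proof -
  define bad where "bad x \<longleftrightarrow> (\<forall>w\<in>W. r x w z) \<and> \<not> (\<exists>b\<in>S. (\<forall>w\<in>W. r x w b) \<and> r x b z)" for x
  have badm[measurable]: "Measurable.pred \<mu> bad" unfolding bad_def by measurable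
  have le: "real (N + 1) * pr bad \<le> 1" for N
  proof -
    obtain B where B: "B \<subseteq> S" "finite B" "card B = N"
      and ex: "\<And>b. b \<in> B \<Longrightarrow> \<exists>g\<in>G. g ` (W \<union> {z} \<union> B) = W \<union> {z} \<union> B \<and> (\<forall>w\<in>W. g w = w) \<and> g z = b"
      using exchange_family[OF W S hyp, of N] by blast
    define L where "L v x \<longleftrightarrow> (\<forall>w\<in>W. r x w v) \<and> (\<forall>u\<in>insert z B. u \<noteq> v \<longrightarrow> (\<forall>w\<in>W. r x w u) \<longrightarrow> r x v u)" for v x
    have Lm[measurable]: "Measurable.pred \<mu> (L v)" for v
      unfolding L_def by measurable
    have zB: "z \<notin> B" using B(1) SZ by auto
    \<comment> \<open>At a bad point no element of \<open>B\<close> falls into the interval, so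
      \<open>z\<close> itself is the least candidate.\<close>
    have bL: "L z x" if "x \<in> topspace X" "bad x" for x
      using that B(1) SZ not_r_iff[of x _ z] unfolding L_def bad_def by blast
    have eq: "pr (L b) = pr (L z)" if b: "b \<in> insert z B" for b
    proof (cases "b = z")
      case False
      then obtain g where g: "g \<in> G" "g ` (W \<union> {z} \<union> B) = W \<union> {z} \<union> B" "\<And>w. w \<in> W \<Longrightarrow> g w = w" "g z = b"
        using ex b by blast
      have inj: "inj g" using bij_G[OF g(1)] bij_is_inj by blast
      have gW: "g ` W = W" using g(3) by (auto simp: image_iff)
      have "insert z B = (W \<union> {z} \<union> B) - W" using zW B(1) SZ by auto
      then have "g ` insert z B = g ` (W \<union> {z} \<union> B) - g ` W" using image_set_diff[OF inj] by metis
      then have gB: "g ` insert z B = insert z B" unfolding g(2) gW using zW B(1) SZ by auto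
      have "L b (act g x) = L z x" if x: "x \<in> topspace X" for x
      proof -
        have 1: "r (act g x) w (g u) = r x w u" if "w \<in> W" for w u
          using r_act[OF g(1) x, of w u] g(3)[OF that] by simp
        have 2: "r (act g x) b (g u) = r x z u" for u using r_act[OF g(1) x, of z u] g(4) by simp
        have "L b (act g x) \<longleftrightarrow> (\<forall>w\<in>W. r (act g x) w (g z)) \<and>
            (\<forall>u\<in>g ` insert z B. u \<noteq> g z \<longrightarrow> (\<forall>w\<in>W. r (act g x) w u) \<longrightarrow> r (act g x) b u)"
          unfolding gB L_def g(4) ..
        also have "\<dots> \<longleftrightarrow> L z x"
          unfolding L_def using 1 2 inj by (simp add: inj_eq)
        finally show ?thesis .
      qed
      then have "pr (\<lambda>x. L b (act g x)) = pr (L z)" by (rule pr_cong)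
      then show ?thesis using pr_inv[OF g(1) Lm, of b] by simp
    qed simp
    have "(\<Sum>v\<in>insert z B. measure \<mu> {x\<in>space \<mu>. L v x}) = measure \<mu> (\<Union>v\<in>insert z B. {x\<in>space \<mu>. L v x})"
    proof (rule finite_measure_finite_Union[symmetric])
      show "disjoint_family_on (\<lambda>v. {x\<in>space \<mu>. L v x}) (insert z B)"
        unfolding disjoint_family_on_def
      proof (intro ballI impI equals0I)
        fix v v' x assume *: "v \<in> insert z B" "v' \<in> insert z B" "v \<noteq> v'"
          "x \<in> {x\<in>space \<mu>. L v x} \<inter> {x\<in>space \<mu>. L v' x}"
        then have x: "x \<in> topspace X" and L: "L v x" "L v' x" by (auto simp: space_mu)
        have "r x v v'" "r x v' v"
          using L(1)[unfolded L_def] L(2)[unfolded L_def] *(1-3) by metis+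
        then show False using r_asym[OF x] by blast
      qed
    qed (use B pred_sets[OF Lm] in \<open>auto simp: space_mu\<close>)
    also have "\<dots> \<le> 1" by simp
    finally have "(\<Sum>v\<in>insert z B. pr (L v)) \<le> 1" by (simp add: pr_def)
    moreover have "(\<Sum>v\<in>insert z B. pr (L v)) = (\<Sum>v\<in>insert z B. pr (L z))"
      by (rule sum.cong[OF refl]) (rule eq)
    ultimately have "real (N + 1) * pr (L z) \<le> 1" using B(2,3) zB by simp
    moreover have "pr bad \<le> pr (L z)" using bL by (intro pr_mono) auto
    ultimately show ?thesis by (meson mult_left_mono of_nat_0_le_iff order_trans)
  qed
  have "pr bad = 0"
  proof (rule ccontr)
    assume "pr bad \<noteq> 0"
    then have pos: "pr bad > 0" by (simp add: pr_def less_le)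
    obtain N where "1 / pr bad < real N" using reals_Archimedean2 by blast
    then have "1 < real (N + 1) * pr bad" using pos by (simp add: field_simps)
    then show False using le[of N] by simp
  qed
  then have "AE x in \<mu>. \<not> bad x"
    using prob_eq_0[of "{x\<in>space \<mu>. bad x}"] by (auto simp: pr_def)
  then show ?thesis by eventually_elim (auto simp: bad_def)
qed

text \<open>The elements of \<open>S'\<close> are grouped into disjoint consecutive pairs. Each pair
  has its first element below \<open>z\<close> and its second above with probability 1/6, so some
  point sees this infinitely often and has infinitely many elements on both sides of
  \<open>z\<close>.\<close>

lemma exists_below_AE:
  assumes S: "infinite S" and zS: "z \<notin> S"
    and q6: "\<And>b b'. b \<in> S \<Longrightarrow> b' \<in> S \<Longrightarrow> b \<noteq> b' \<Longrightarrow> prob3 b z b' = 1 / 6"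
  shows "AE x in \<mu>. \<exists>b\<in>S. r x b z"
proof -
  have "AE x in \<mu>. (\<forall>w\<in>{}. r x w z) \<longrightarrow> (\<exists>b\<in>S. (\<forall>w\<in>{}. r x w b) \<and> r x b z)"
  proof (rule exists_below_above_AE[OF _ S])
    fix S' assume S': "S' \<subseteq> S" "infinite S'"
    define e where "e = enumerate S'"
    have eS: "e k \<in> S'" for k using S'(2) by (simp add: e_def enumerate_in_set)
    have ie: "inj e" unfolding e_def using strict_mono_enumerate[OF S'(2)] by (rule strict_mono_imp_inj_on)
    have ev: "inj (\<lambda>k. e (2 * k))" "inj (\<lambda>k. e (2 * k + 1))" by (rule injI, use injD[OF ie] in fastforce)+
    have "\<exists>x\<in>topspace X. True \<and> infinite {k. ordered3 x (e (2 * k)) z (e (2 * k + 1))}"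
    proof (rule exists_infinitely_often)
      show "1 / 6 \<le> pr (\<lambda>x. ordered3 x (e (2 * k)) z (e (2 * k + 1)))" for k
        using q6[of "e (2 * k)" "e (2 * k + 1)"] eS S'(1) ie
        by (simp add: prob3_def inj_eq subset_iff)
    qed auto
    then obtain x where x: "x \<in> topspace X" and inf: "infinite {k. ordered3 x (e (2 * k)) z (e (2 * k + 1))}" by blast
    let ?I = "{k. ordered3 x (e (2 * k)) z (e (2 * k + 1))}"
    have "infinite ((\<lambda>k. e (2 * k)) ` ?I)" "infinite ((\<lambda>k. e (2 * k + 1)) ` ?I)"
      using inf ev by (meson finite_imageD inj_on_subset subset_UNIV)+
    then show "\<exists>x\<in>topspace X. \<exists>P Q. P \<subseteq> S' \<and> Q \<subseteq> S' \<and> infinite P \<and> infinite Q \<and>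
       (\<forall>w\<in>{}. r x w z) \<and> (\<forall>w\<in>{}. \<forall>p\<in>P. r x w p) \<and> (\<forall>p\<in>P. r x p z) \<and> (\<forall>q\<in>Q. r x z q)"
      using x eS by (intro bexI[of _ x] exI[of _ "(\<lambda>k. e (2 * k)) ` ?I"] exI[of _ "(\<lambda>k. e (2 * k + 1)) ` ?I"])
        (auto simp: ordered3_def)
  qed (use zS in auto)
  then show ?thesis by simp
qed

lemma exists_above_AE:
  assumes "infinite S" "z \<notin> S"
    and "\<And>b b'. b \<in> S \<Longrightarrow> b' \<in> S \<Longrightarrow> b \<noteq> b' \<Longrightarrow> prob3 b z b' = 1 / 6"
  shows "AE x in \<mu>. \<exists>b\<in>S. r x z b"
proof -
  interpret conv: measured_flow G X act "\<lambda>x i j. r x j i" \<mu>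
    by (rule measured_flow_converse) unfold_locales
  have "conv.prob3 u v w = prob3 w v u" for u v w
    unfolding conv.prob3_def prob3_def conv.pr_def pr_def conv.ordered3_def ordered3_def by (simp add: conj_commute)
  then show ?thesis using conv.exists_below_AE[OF assms(1,2)] assms(3) by metis
qed

text \<open>Applied to all tails of \<open>S'\<close>, \<open>exists_above_AE\<close> gives
  infinitely many elements above \<open>z\<close> almost surely. Inside this event there is a point
  at which infinitely many elements lie between \<open>w\<close> and \<open>z\<close>, each doing so
  with probability 1/6.\<close>

lemma exists_between_AE:
  assumes S: "infinite S" and zw: "z \<noteq> w" "z \<notin> S" "w \<notin> S"
    and q6: "\<And>b b'. b \<in> S \<Longrightarrow> b' \<in> S \<Longrightarrow> b \<noteq> b' \<Longrightarrow> prob3 b z b' = 1 / 6"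
    and q6': "\<And>b. b \<in> S \<Longrightarrow> prob3 w b z = 1 / 6"
  shows "AE x in \<mu>. r x w z \<longrightarrow> (\<exists>b\<in>S. r x w b \<and> r x b z)"
proof -
  have "AE x in \<mu>. (\<forall>w\<in>{w}. r x w z) \<longrightarrow> (\<exists>b\<in>S. (\<forall>w\<in>{w}. r x w b) \<and> r x b z)"
  proof (rule exists_below_above_AE[OF _ S])
    fix S' assume S': "S' \<subseteq> S" "infinite S'"
    define e where "e = enumerate S'"
    have eS: "e k \<in> S'" for k using S'(2) by (simp add: e_def enumerate_in_set)
    have ie: "inj e" unfolding e_def using strict_mono_enumerate[OF S'(2)] by (rule strict_mono_imp_inj_on)
    have "AE x in \<mu>. \<exists>b\<in>S' \<inter> {n..}. r x z b" for n
    proof (rule exists_above_AE)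
      have "S' \<subseteq> (S' \<inter> {n..}) \<union> {..<n}" by auto
      then show "infinite (S' \<inter> {n..})" using S'(2) by (meson finite_Un finite_lessThan finite_subset)
    qed (use zw S'(1) q6 in auto)
    then have AE: "AE x in \<mu>. \<forall>n. \<exists>b\<in>S' \<inter> {n..}. r x z b" by (simp add: AE_all_countable)
    have "\<exists>x\<in>topspace X. (\<forall>n. \<exists>b\<in>S' \<inter> {n..}. r x z b) \<and> infinite {k. ordered3 x w (e k) z}"
    proof (rule exists_infinitely_often[OF _ _ _ AE])
      show "1 / 6 \<le> pr (\<lambda>x. ordered3 x w (e k) z)" for k
        using q6'[of "e k"] eS S'(1) by (simp add: prob3_def subset_iff)
    qed auto
    then obtain x where x: "x \<in> topspace X" and above: "\<And>n. \<exists>b\<in>S' \<inter> {n..}. r x z b"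
      and inf: "infinite {k. ordered3 x w (e k) z}" by blast
    have 1: "infinite (e ` {k. ordered3 x w (e k) z})"
      using inf ie by (meson finite_imageD inj_on_subset subset_UNIV)
    have 2: "infinite {b\<in>S'. r x z b}"
      unfolding infinite_nat_iff_unbounded_le using above by fastforce
    obtain k where "ordered3 x w (e k) z" using inf infinite_imp_nonempty by blast
    then have "r x w z" using r_trans[OF x] by (auto simp: ordered3_def)
    then show "\<exists>x\<in>topspace X. \<exists>P Q. P \<subseteq> S' \<and> Q \<subseteq> S' \<and> infinite P \<and> infinite Q \<and>
       (\<forall>w\<in>{w}. r x w z) \<and> (\<forall>w\<in>{w}. \<forall>p\<in>P. r x w p) \<and> (\<forall>p\<in>P. r x p z) \<and> (\<forall>q\<in>Q. r x z q)"
      using x eS 1 2 by (intro bexI[of _ x] exI[of _ "e ` {k. ordered3 x w (e k) z}"] exI[of _ "{b\<in>S'. r x z b}"])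
        (auto simp: ordered3_def)
  qed (use zw in auto)
  then show ?thesis by simp
qed

end

subsection \<open>The generic orbit\<close>

context measured_flow
begin

text \<open>Used to empty an exceptional set: its points realise no conjugate of the extension, yet
  if it is open and nonempty, it contains a translate of a point that does.\<close>

lemma open_invariant_meets_extension:
  assumes A: "finite A" and x0: "x0 \<in> topspace X"
    and E: "openin X E" "E \<subseteq> cyl A x0" "E \<noteq> {}"
  shows "\<exists>g\<in>stab A. \<exists>v\<in>cyl (insert b A) x0. act g v \<in> E"
proof (rule stab_transitive[OF A x0 E(1,3,2)])
  show "openin X (cyl (insert b A) x0)" using open_cyl A by simp
  show "cyl (insert b A) x0 \<noteq> {}" using cyl_self[OF x0] by blast
  show "cyl (insert b A) x0 \<subseteq> cyl A x0" using agree_mono by (auto simp: cyl_def)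
qed

text \<open>\<open>S\<close> is the orbit of \<open>b\<close> over \<open>A\<close>, and
  \<open>E\<close> collects the exceptional points, with all of \<open>S\<close> above
  \<open>a\<close>. If \<open>S\<close> is finite, or always on one side of \<open>a\<close>,
  finitely many relations decide \<open>E\<close>, so \<open>E\<close> is open and thus empty. It is
  also empty if \<open>a\<close> always separates two elements of \<open>S\<close>. Otherwise one
  triple has all six orders, and this spreads to all of \<open>S\<close>.\<close>

lemma conjugate_below_AE:
  assumes A: "finite A" and x0: "x0 \<in> topspace X" and a: "a \<in> A" and b: "b \<notin> A"
    and swappable: "swappable a b" and ba: "r x0 b a"
  shows "AE x in \<mu>. agree A x0 x \<longrightarrow> (\<exists>h\<in>stab A. r x (h b) a)"
proof -
  define S where "S = (\<lambda>h. h b) ` stab A"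
  define E where "E = {x\<in>topspace X. agree A x0 x \<and> (\<forall>s\<in>S. r x a s)}"
  have bS: "b \<in> S" unfolding S_def by (rule image_eqI[OF _ id_stab]) simp
  have aS: "a \<notin> S"
    using a b bij_G by (auto simp: S_def stab_def) (metis bij_is_inj injD)
  have swS: "swappable a s" if "s \<in> S" for s
    using that swappable_act[OF stab_G swappable] a by (auto simp: S_def stab_def) metis
  have swSS: "swappable s s'" if "s \<in> S" "s' \<in> S" "s \<noteq> s'" for s s'
    using swappable_trans[OF swappable_sym[OF swS[OF that(1)]] swS[OF that(2)] that(3)] .
  have E_empty: "E = {}" if op: "openin X E"
  proof (rule ccontr)
    assume "E \<noteq> {}"
    then obtain g v where g: "g \<in> stab A" and v: "v \<in> cyl (insert b A) x0" "act g v \<in> E"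
      using open_invariant_meets_extension[OF A x0 op, of b] by (auto simp: E_def cyl_def)
    have "r (act g v) a (g b)" using v(2) g by (auto simp: E_def S_def)
    then have "r v a b" using r_act[OF stab_G[OF g], of v a b] g a v(1) by (auto simp: stab_def cyl_def)
    moreover have "r v b a" using v(1) ba a by (auto simp: cyl_def agree_def)
    ultimately show False using r_asym v(1) by (auto simp: cyl_def)
  qed
  have fromE: ?thesis if "E = {}"
  proof (rule AE_I2, rule impI)
    fix x assume "x \<in> space \<mu>" "agree A x0 x"
    then show "\<exists>h\<in>stab A. r x (h b) a"
      using that r_total[of x a] aS unfolding E_def S_def space_mu by blast
  qed
  show ?thesis
  proof (cases "finite S")
    case True
    have "openin X E"
      by (rule open_if_finitary[of "A \<union> S"]) (use A True a in \<open>auto simp: E_def agree_def\<close>)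
    then show ?thesis using fromE E_empty by blast
  next
    case inf: False
    consider (all_orders) b1 b2 where "b1 \<in> S" "b2 \<in> S" "b1 \<noteq> b2" "all_orders a b1 b2"
      | (mid) b1 b2 where "b1 \<in> S" "b2 \<in> S" "\<forall>x\<in>topspace X. between x b1 a b2"
      | (side) "\<And>b1 b2. b1 \<in> S \<Longrightarrow> b2 \<in> S \<Longrightarrow> b1 \<noteq> b2 \<Longrightarrow>
          (\<forall>x\<in>topspace X. between x a b1 b2) \<or> (\<forall>x\<in>topspace X. between x a b2 b1)"
      using all_orders_cases[OF swS swSS swS] by metis
    then show ?thesis
    proof cases
      case all_orders
      \<comment> \<open>Pairs are replaced one point at a time: from \<open>b2, b1\<close> to
        \<open>b1, d\<close>, then from \<open>b1, c\<close> to \<open>c, d\<close>.\<close>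
      have ext: "all_orders a c d" if "all_orders a e c" "c \<in> S" "d \<in> S" "e \<in> S" "c \<noteq> d" "e \<noteq> d" "e \<noteq> c" for c d e
        using all_orders_extend[of a e c d] that swS swSS by blast
      have one: "all_orders a b1 d" if "d \<in> S" "d \<noteq> b1" for d
        using ext[of b2 b1 d] all_orders all_orders_perms that by metis
      have "all_orders a c d" if "c \<in> S" "d \<in> S" "c \<noteq> d" for c d
        using ext[of b1 c d] one[of c] one[of d] all_orders_perms all_orders(1) that by metis
      then have q6: "prob3 c a d = 1 / 6" if "c \<in> S" "d \<in> S" "c \<noteq> d" for c d
        using all_orders_q[of c a d] all_orders_perms swS swSS swappable_sym that by metis
      have "AE x in \<mu>. \<exists>s\<in>S. r x s a" using exists_below_AE[OF inf aS] q6 by blast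
      then show ?thesis by eventually_elim (auto simp: S_def)
    next
      case mid
      have "E = {}" using mid r_asym unfolding E_def between_def ordered3_def by blast
      then show ?thesis using fromE by blast
    next
      case side
      \<comment> \<open>Neither \<open>b1\<close> nor \<open>b2\<close> is ever separated from the
        other by \<open>a\<close>, so the position of \<open>b\<close> alone decides whether a point
        belongs to \<open>E\<close>.\<close>
      have same: "r x a b1 \<longleftrightarrow> r x a b2" if x: "x \<in> topspace X" and bb: "b1 \<in> S" "b2 \<in> S" for x b1 b2
      proof (cases "b1 = b2")
        case False
        then have "between x a b1 b2 \<or> between x a b2 b1" using side[OF bb] x by blast
        then show ?thesis using r_trans[OF x] r_asym[OF x] unfolding between_def ordered3_def by blast
      qed simp
      have "openin X E"
      proof (rule open_if_finitary[of "insert b A"])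
        fix x y assume x: "x \<in> E" and y: "y \<in> topspace X" "agree (insert b A) x y"
        have "r x a b" using x bS by (auto simp: E_def)
        then have "r y a b" using y a by (auto simp: agree_def)
        then have "r y a s" if "s \<in> S" for s using same[OF y(1) that bS] by simp
        moreover have "agree A x0 y"
          using x agree_trans[OF _ agree_mono[OF y(2), of A]] by (auto simp: E_def)
        ultimately show "y \<in> E" using y by (auto simp: E_def)
      qed (use A in \<open>auto simp: E_def\<close>)
      then show ?thesis using fromE E_empty by blast
    qed
  qed
qed

lemma conjugate_above_AE:
  assumes A: "finite A" and x0: "x0 \<in> topspace X" and a: "a \<in> A" and b: "b \<notin> A"
    and swappable: "swappable a b" and ab: "r x0 a b"
  shows "AE x in \<mu>. agree A x0 x \<longrightarrow> (\<exists>h\<in>stab A. r x a (h b))"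
proof -
  interpret conv: measured_flow G X act "\<lambda>x i j. r x j i" \<mu>
    by (rule measured_flow_converse) unfold_locales
  have "conv.agree A x y = agree A x y" for x y by (auto simp: agree_def conv.agree_def)
  moreover have "conv.swappable a b" using swappable by (auto simp: swappable_def conv.swappable_def)
  ultimately show ?thesis using conv.conjugate_below_AE[OF A x0 a b _ ab] by simp
qed

text \<open>At \<open>x0\<close> the middle is \<open>b\<close>, so either \<open>b\<close> is
  always the middle and \<open>id\<close> works, or all six orders occur. In the second case a
  finite orbit of \<open>b\<close> is settled by transitivity and an infinite one by
  \<open>exists_between_AE\<close>.\<close>

lemma conjugate_between_AE:
  assumes A: "finite A" and x0: "x0 \<in> topspace X" and a: "a \<in> A" "a' \<in> A" and b: "b \<notin> A"
    and swappable: "swappable a b" "swappable b a'" and aba: "r x0 a b" "r x0 b a'"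
  shows "AE x in \<mu>. agree A x0 x \<longrightarrow> (\<exists>h\<in>stab A. r x a (h b) \<and> r x (h b) a')"
proof -
  have aa0: "r x0 a a'" using aba r_trans[OF x0] by blast
  have aa: "a \<noteq> a'" using aa0 r_irrefl[OF x0] by blast
  have swaa: "swappable a a'" using swappable_trans[OF swappable aa] .
  have not_mid: "\<not> between x0 a a' b" "\<not> between x0 b a a'"
    using aba aa0 r_asym[OF x0] r_trans[OF x0] unfolding between_def ordered3_def by blast+
  consider (mid) "\<forall>x\<in>topspace X. between x a b a'" | (all_orders) "all_orders a b a'"
    using all_orders_cases[OF swappable(1,2) swaa] not_mid x0 by blast
  then show ?thesis
  proof cases
    case mid
    show ?thesis
    proof (rule AE_I2, rule impI)
      fix x assume x: "x \<in> space \<mu>" and ag: "agree A x0 x"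
      have xX: "x \<in> topspace X" using x space_mu by simp
      have "r x a a'" using ag a aa0 by (auto simp: agree_def)
      then have "r x a b \<and> r x b a'"
        using mid xX r_asym[OF xX] r_trans[OF xX] unfolding between_def ordered3_def by blast
      then show "\<exists>h\<in>stab A. r x a (h b) \<and> r x (h b) a'" by (intro bexI[OF _ id_stab]) simp
    qed
  next
    case all_orders
    define S where "S = (\<lambda>h. h b) ` stab A"
    have notS: "c \<notin> S" if "c \<in> A" for c
      using that b bij_G by (auto simp: S_def stab_def) (metis bij_is_inj injD)
    have swS: "swappable a s" "swappable s a'" "all_orders a s a'" if s: "s \<in> S" for s
    proof -
      obtain h where h: "h \<in> G" "s = h b" "h a = a" "h a' = a'" using s a by (auto simp: S_def stab_def)
      show "swappable a s" "swappable s a'" "all_orders a s a'"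
        using swappable_act[OF h(1) swappable(1)] swappable_act[OF h(1) swappable(2)] all_orders_act[OF h(1) all_orders] h by auto
    qed
    have swSS: "swappable s s'" if "s \<in> S" "s' \<in> S" "s \<noteq> s'" for s s'
      using swappable_trans[OF swappable_sym[OF swS(1)[OF that(1)]] swS(1)[OF that(2)] that(3)] .
    show ?thesis
    proof (cases "finite S")
      case True
      define E where "E = {x\<in>topspace X. agree A x0 x \<and> (\<forall>s\<in>S. \<not> (r x a s \<and> r x s a'))}"
      have op: "openin X E"
        by (rule open_if_finitary[of "A \<union> S"]) (use A True a in \<open>auto simp: E_def agree_def\<close>)
      have "E = {}"
      proof (rule ccontr)
        assume "E \<noteq> {}"
        then obtain g v where g: "g \<in> stab A" and v: "v \<in> cyl (insert b A) x0" "act g v \<in> E"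
          using open_invariant_meets_extension[OF A x0 op, of b] by (auto simp: E_def cyl_def)
        have vX: "v \<in> topspace X" using v(1) by (simp add: cyl_def)
        have "\<not> (r (act g v) (g a) (g b) \<and> r (act g v) (g b) (g a'))"
          using v(2) g a by (auto simp: E_def S_def stab_def)
        then have "\<not> (r v a b \<and> r v b a')" using r_act[OF stab_G[OF g] vX] by simp
        moreover have "r v a b" "r v b a'" using v(1) aba a by (auto simp: cyl_def agree_def)
        ultimately show False by blast
      qed
      then show ?thesis by (intro AE_I2) (auto simp: E_def S_def space_mu)
    next
      case inf: False
      have "prob3 s a' s' = 1 / 6" if s: "s \<in> S" "s' \<in> S" "s \<noteq> s'" for s s'
      proof -
        have "all_orders a' s s'"
          using all_orders_extend[of a' a s s'] swS[OF s(1)] swS[OF s(2)] swSS[OF s] swaa swappable_sym all_orders_perms by blast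
        then show ?thesis
          using all_orders_q[OF swS(2)[OF s(1)] swappable_sym[OF swS(2)[OF s(2)]] swSS[OF s]] all_orders_perms(2) by blast
      qed
      moreover have "prob3 a s a' = 1 / 6" if "s \<in> S" for s
        using all_orders_q[OF swS(1,2)[OF that] swaa swS(3)[OF that]] .
      ultimately have "AE x in \<mu>. r x a a' \<longrightarrow> (\<exists>s\<in>S. r x a s \<and> r x s a')"
        using exists_between_AE[OF inf, of a' a] aa notS a by blast
      then show ?thesis
      proof eventually_elim
        case (elim x)
        then show ?case using aa0 a by (auto simp: S_def agree_def)
      qed
    qed
  qed
qed

section \<open>One-point extensions hold almost surely\<close>

lemma linear_max_exists:
  assumes "x \<in> topspace X" "finite B" "B \<noteq> {}"
  shows "\<exists>a\<in>B. \<forall>c\<in>B. c = a \<or> r x c a"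
  using assms(2,3)
proof (induction rule: finite_ne_induct)
  case (insert c B)
  then obtain a where a: "a \<in> B" "\<forall>c\<in>B. c = a \<or> r x c a" by blast
  show ?case
  proof (cases "r x a c")
    case True
    then have "\<forall>d\<in>B. r x d c" using a r_trans[OF assms(1), of _ a c] by metis
    then show ?thesis by blast
  next
    case False
    moreover have "a \<noteq> c" using a insert.hyps by blast
    ultimately show ?thesis using a r_total[OF assms(1), of a c] by blast
  qed
qed simp

lemma linear_min_exists:
  assumes "x \<in> topspace X" "finite B" "B \<noteq> {}"
  shows "\<exists>a\<in>B. \<forall>c\<in>B. c = a \<or> r x a c"
  using assms(2,3)
proof (induction rule: finite_ne_induct)
  case (insert c B)
  then obtain a where a: "a \<in> B" "\<forall>c\<in>B. c = a \<or> r x a c" by blast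
  show ?case
  proof (cases "r x c a")
    case True
    then have "\<forall>d\<in>B. r x c d" using a r_trans[OF assms(1), of c a] by metis
    then show ?thesis by blast
  next
    case False
    moreover have "a \<noteq> c" using a insert.hyps by blast
    ultimately show ?thesis using a r_total[OF assms(1), of a c] by blast
  qed
qed simp

text \<open>A conjugate of \<open>b\<close> is wanted in a prescribed cut of \<open>A\<close>. Only
  the largest element below the cut and the smallest one above it matter, so at most two constraints
  remain.\<close>

lemma extension_AE:
  assumes A: "finite A" and x0: "x0 \<in> topspace X"
  shows "AE x in \<mu>. agree A x0 x \<longrightarrow> (\<exists>g\<in>stab A. agree (insert b A) x0 (act g x))"
proof (cases "b \<in> A")
  case True
  show ?thesis
  proof (rule AE_I2, rule impI)
    fix x assume x: "x \<in> space \<mu>" "agree A x0 x"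
    then have "agree (insert b A) x0 (act id x)" using True act_id space_mu by (simp add: insert_absorb)
    then show "\<exists>g\<in>stab A. agree (insert b A) x0 (act g x)" using id_stab by blast
  qed
next
  case b: False
  define Lo where "Lo = {c\<in>A. r x0 c b}"
  define Up where "Up = {c\<in>A. r x0 b c}"
  have fin: "finite Lo" "finite Up" using A by (auto simp: Lo_def Up_def)
  have AE: "AE x in \<mu>. agree A x0 x \<longrightarrow> (\<exists>h\<in>stab A. (\<forall>c\<in>Lo. r x c (h b)) \<and> (\<forall>c\<in>Up. r x (h b) c))"
  proof -
    have const_lo: "r x a (h b)" if "\<not> swappable a b" "a \<in> Lo" "h \<in> stab A" "x \<in> topspace X" for a h x
    proof -
      have h: "h \<in> G" "h a = a" using that by (auto simp: stab_def Lo_def)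
      have ix: "act (inv h) x \<in> topspace X" using h that act_in inv_G by blast
      have "r (act (inv h) x) a b" using not_swappable_const[of a b x0] that x0 ix by (auto simp: Lo_def)
      then show ?thesis using r_act[OF h(1) ix, of a b] act_inv(2)[OF h(1) that(4)] h(2) by simp
    qed
    have const_up: "r x (h b) a" if "\<not> swappable b a" "a \<in> Up" "h \<in> stab A" "x \<in> topspace X" for a h x
    proof -
      have h: "h \<in> G" "h a = a" using that by (auto simp: stab_def Up_def)
      have ix: "act (inv h) x \<in> topspace X" using h that act_in inv_G by blast
      have "r (act (inv h) x) b a" using not_swappable_const[of b a x0] that x0 ix by (auto simp: Up_def)
      then show ?thesis using r_act[OF h(1) ix, of b a] act_inv(2)[OF h(1) that(4)] h(2) by simp
    qed
    have AA: "AE x in \<mu>. agree A x0 x \<longrightarrow> (\<exists>h\<in>stab A. r x a (h b))" if "a \<in> Lo" for a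
    proof (cases "swappable a b")
      case True
      then show ?thesis using conjugate_above_AE[OF A x0 _ b True] that by (auto simp: Lo_def)
    next
      case False
      then show ?thesis using const_lo[OF False that id_stab]
        by (intro AE_I2 impI bexI[OF _ id_stab]) (simp add: space_mu)
    qed
    have BB: "AE x in \<mu>. agree A x0 x \<longrightarrow> (\<exists>h\<in>stab A. r x (h b) a)" if "a \<in> Up" for a
    proof (cases "swappable b a")
      case True
      then show ?thesis using conjugate_below_AE[OF A x0 _ b swappable_sym[OF True]] that by (auto simp: Up_def)
    next
      case False
      then show ?thesis using const_up[OF False that id_stab]
        by (intro AE_I2 impI bexI[OF _ id_stab]) (simp add: space_mu)
    qed
    have AB: "AE x in \<mu>. agree A x0 x \<longrightarrow> (\<exists>h\<in>stab A. r x a (h b) \<and> r x (h b) a')"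
      if aa: "a \<in> Lo" "a' \<in> Up" for a a'
    proof -
      \<comment> \<open>An end point that is not swappable with \<open>b\<close> is on the correct
        side of every conjugate of \<open>b\<close>, so the constraint at the other end
        suffices.\<close>
      consider "swappable a b" "swappable b a'" | "\<not> swappable a b" | "\<not> swappable b a'" by blast
      then show ?thesis
      proof cases
        case 1
        then show ?thesis using conjugate_between_AE[OF A x0 _ _ b 1] aa by (auto simp: Lo_def Up_def)
      next
        case 2
        show ?thesis using BB[OF aa(2)] AE_space
          by eventually_elim (use const_lo[OF 2 aa(1)] space_mu in blast)
      next
        case 3
        show ?thesis using AA[OF aa(1)] AE_space
          by eventually_elim (use const_up[OF 3 aa(2)] space_mu in blast)
      qed
    qed
    have lo: "\<forall>c\<in>Lo. r x c s"
      if x: "x \<in> topspace X" "agree A x0 x" and a: "a \<in> Lo" "\<forall>c\<in>Lo. c = a \<or> r x0 c a" and s: "r x a s" for x a s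
    proof
      fix c assume c: "c \<in> Lo"
      then have "c = a \<or> r x c a" using a x(2) by (auto simp: agree_def Lo_def)
      then show "r x c s" using s r_trans[OF x(1)] by blast
    qed
    have up: "\<forall>c\<in>Up. r x s c"
      if x: "x \<in> topspace X" "agree A x0 x" and a: "a \<in> Up" "\<forall>c\<in>Up. c = a \<or> r x0 a c" and s: "r x s a" for x a s
    proof
      fix c assume c: "c \<in> Up"
      then have "c = a \<or> r x a c" using a x(2) by (auto simp: agree_def Up_def)
      then show "r x s c" using s r_trans[OF x(1)] by blast
    qed
    consider "Lo = {}" "Up = {}" | "Lo \<noteq> {}" "Up = {}" | "Lo = {}" "Up \<noteq> {}" | "Lo \<noteq> {}" "Up \<noteq> {}" by blast
    then show ?thesis
    proof cases
      case 1
      then show ?thesis by (intro AE_I2 impI bexI[OF _ id_stab]) auto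
    next
      case 2
      obtain a where a: "a \<in> Lo" "\<forall>c\<in>Lo. c = a \<or> r x0 c a" using linear_max_exists[OF x0 fin(1) 2(1)] by blast
      show ?thesis using AA[OF a(1)] AE_space
        by eventually_elim (use lo[OF _ _ a] 2(2) space_mu in blast)
    next
      case 3
      obtain a where a: "a \<in> Up" "\<forall>c\<in>Up. c = a \<or> r x0 a c" using linear_min_exists[OF x0 fin(2) 3(2)] by blast
      show ?thesis using BB[OF a(1)] AE_space
        by eventually_elim (use up[OF _ _ a] 3(1) space_mu in blast)
    next
      case 4
      obtain a where a: "a \<in> Lo" "\<forall>c\<in>Lo. c = a \<or> r x0 c a" using linear_max_exists[OF x0 fin(1) 4(1)] by blast
      obtain a' where a': "a' \<in> Up" "\<forall>c\<in>Up. c = a' \<or> r x0 a' c" using linear_min_exists[OF x0 fin(2) 4(2)] by blast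
      show ?thesis using AB[OF a(1) a'(1)] AE_space
        by eventually_elim (use lo[OF _ _ a] up[OF _ _ a'] space_mu in blast)
    qed
  qed
  show ?thesis using AE AE_space
  proof eventually_elim
    case (elim x)
    show ?case
    proof
      assume ag: "agree A x0 x"
      have x: "x \<in> topspace X" using elim space_mu by simp
      obtain h where h: "h \<in> stab A" and lo: "\<And>c. c \<in> Lo \<Longrightarrow> r x c (h b)" and up: "\<And>c. c \<in> Up \<Longrightarrow> r x (h b) c"
        using elim(1) ag by blast
      have g: "inv h \<in> stab A" "inv h \<in> G" using inv_stab[OF h] stab_G by auto
      \<comment> \<open>Applying \<open>inv h\<close> puts \<open>b\<close> where the conjugate
        \<open>h b\<close> was, and leaves \<open>A\<close> in place.\<close>
      have eq: "r (act (inv h) x) i j = r x (h i) (h j)" for i j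
        using r_act[OF g(2) x, of "h i" "h j"] inv_simps[OF stab_G[OF h]] by simp
      have hA: "h c = c" if "c \<in> A" for c using h that by (simp add: stab_def)
      have cases: "c \<in> Lo \<or> c \<in> Up" if "c \<in> A" for c
        using that b r_total[OF x0, of c b] by (auto simp: Lo_def Up_def)
      have 1: "r x0 c b = r x c (h b)" "r x0 b c = r x (h b) c" if c: "c \<in> A" for c
        using cases[OF c] lo[of c] up[of c] r_asym[OF x] r_asym[OF x0] unfolding Lo_def Up_def by blast+
      have "agree (insert b A) x0 (act (inv h) x)"
        unfolding agree_def eq
        using 1 hA ag r_irrefl[OF x0] r_irrefl[OF x] by (auto simp: agree_def)
      then show "\<exists>g\<in>stab A. agree (insert b A) x0 (act g x)" using g(1) by blast
    qed
  qed
qed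

text \<open>The extension property that characterises a Fraisse limit, for the finite orders that
  occur in \<open>X\<close>.\<close>

definition generic :: "'a set" where
  "generic = {x\<in>topspace X. \<forall>A b. \<forall>x0\<in>topspace X. finite A \<longrightarrow> agree A x0 x \<longrightarrow>
     (\<exists>g\<in>stab A. agree (insert b A) x0 (act g x))}"

lemma generic_act:
  assumes x: "x \<in> generic" and k: "k \<in> G"
  shows "act k x \<in> generic"
proof -
  have xX: "x \<in> topspace X" using x by (simp add: generic_def)
  have "\<exists>g\<in>stab A. agree (insert b A) x0 (act g (act k x))"
    if A: "finite A" and x0: "x0 \<in> topspace X" and ag: "agree A x0 (act k x)" for A b x0
  proof -
    let ?l = "inv k"
    have l: "?l \<in> G" using inv_G[OF k] .
    have lx0: "act ?l x0 \<in> topspace X" using act_in l x0 by blast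
    have "agree (?l ` A) (act ?l x0) (act ?l (act k x))"
      using agree_act_image[OF l x0 act_in[OF k xX]] ag by simp
    then have "agree (?l ` A) (act ?l x0) x" using act_inv(1)[OF k xX] by simp
    then obtain g where g: "g \<in> stab (?l ` A)" "agree (insert (?l b) (?l ` A)) (act ?l x0) (act g x)"
      using x lx0 A unfolding generic_def by blast
    have gG: "g \<in> G" using stab_G[OF g(1)] .
    define h where "h = k \<circ> g \<circ> ?l"
    have hG: "h \<in> G" using comp_G gG k l by (simp add: h_def)
    have "h \<in> stab A"
      using hG g(1) inv_simps[OF k] by (auto simp: stab_def h_def)
    moreover have "act h (act k x) = act k (act g x)"
    proof -
      have "h \<circ> k = k \<circ> g" using inv_simps[OF k] by (auto simp: h_def)
      then show ?thesis using act_comp[OF hG k xX] act_comp[OF k gG xX] by simp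
    qed
    moreover have "agree (k ` insert (?l b) (?l ` A)) (act k (act ?l x0)) (act k (act g x))"
      by (rule iffD2[OF agree_act_image[OF k lx0 act_in[OF gG xX]] g(2)])
    moreover have "k ` insert (?l b) (?l ` A) = insert b A"
      using inv_simps[OF k] by (auto simp: image_image)
    ultimately show ?thesis using act_inv(2)[OF k x0] by (intro bexI[of _ h]) simp_all
  qed
  then show ?thesis using act_in[OF k xX] unfolding generic_def by blast
qed

text \<open>Back and forth: the group elements produced at successive stages agree on growing finite sets.\<close>
lemma generic_single_orbit:
  assumes x: "x \<in> generic" and y: "y \<in> generic"
  shows "\<exists>g\<in>G. act g x = y"
proof -
  have xX: "x \<in> topspace X" and yX: "y \<in> topspace X" using x y by (auto simp: generic_def)
  define ok where "ok = (\<lambda>(g, A). g \<in> G \<and> finite A \<and> agree A y (act g x))"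
  have go_forth: "\<exists>g' A'. ok (g', A') \<and> A \<subseteq> A' \<and> (\<exists>h\<in>stab A. g' = h \<circ> g) \<and> b \<in> A'"
    if "ok (g, A)" for g A b
  proof -
    have g: "g \<in> G" "finite A" "agree A y (act g x)" using that by (auto simp: ok_def)
    obtain h where h: "h \<in> stab A" "agree (insert b A) y (act h (act g x))"
      using generic_act[OF x g(1)] yX g unfolding generic_def by blast
    have "ok (h \<circ> g, insert b A)"
      using h g comp_G[OF stab_G[OF h(1)] g(1)] act_comp[OF stab_G[OF h(1)] g(1) xX] by (simp add: ok_def)
    then show ?thesis using h(1) by blast
  qed
  \<comment> \<open>Here the extension property of \<open>y\<close> is applied to the order of
    \<open>act g x\<close>. The element found moves \<open>y\<close>, so its inverse is composed
    with the approximation.\<close>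
  have go_back: "\<exists>g' A'. ok (g', A') \<and> A \<subseteq> A' \<and> (\<exists>h\<in>stab A. g' = h \<circ> g) \<and> g' a \<in> A'"
    if "ok (g, A)" for g A a
  proof -
    have g: "g \<in> G" "finite A" "agree A y (act g x)" using that by (auto simp: ok_def)
    have gx: "act g x \<in> topspace X" using act_in g xX by blast
    obtain h where h: "h \<in> stab A" "agree (insert (g a) A) (act g x) (act h y)"
      using y gx g agree_sym unfolding generic_def by blast
    have hG: "h \<in> G" and l: "inv h \<in> G" "inv h \<in> stab A" using stab_G h inv_stab by blast+
    have "agree (inv h ` insert (g a) A) (act (inv h) (act g x)) (act (inv h) (act h y))"
      by (rule iffD2[OF agree_act_image[OF l(1) gx act_in[OF hG yX]] h(2)])
    moreover have "inv h ` insert (g a) A = insert (inv h (g a)) A"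
      using l(2) by (auto simp: stab_def image_iff)
    ultimately have "ok (inv h \<circ> g, insert (inv h (g a)) A)"
      using g l comp_G act_comp[OF l(1) g(1) xX] act_inv(1)[OF hG yX] agree_sym by (simp add: ok_def)
    then show ?thesis using l(2) by (intro exI[of _ "inv h \<circ> g"] exI[of _ "insert (inv h (g a)) A"]) auto
  qed
  \<comment> \<open>Later factors fix the finite set pointwise, so including \<open>n\<close>
    freezes the preimage of \<open>n\<close> and including its image freezes the value at
    \<open>n\<close>. The first makes the limit surjective, the second makes it well
    defined.\<close>
  have step: "\<exists>p'. ok p' \<and> snd p \<subseteq> snd p' \<and> (\<exists>h\<in>stab (snd p). fst p' = h \<circ> fst p) \<and> n \<in> snd p' \<and> fst p' n \<in> snd p'"
    if okp: "ok p" for p n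
  proof -
    obtain g A where p: "p = (g, A)" by (cases p)
    obtain g1 A1 h1 where 1: "ok (g1, A1)" "A \<subseteq> A1" "h1 \<in> stab A" "g1 = h1 \<circ> g" "n \<in> A1"
      using go_forth[of g A n] okp p by blast
    obtain g2 A2 h2 where 2: "ok (g2, A2)" "A1 \<subseteq> A2" "h2 \<in> stab A1" "g2 = h2 \<circ> g1" "g2 n \<in> A2"
      using go_back[OF 1(1), of n] by blast
    have "h2 \<in> stab A" using 2(3) 1(2) by (auto simp: stab_def)
    then have "h2 \<circ> h1 \<in> stab A" using comp_stab 1(3) by blast
    moreover have "g2 = (h2 \<circ> h1) \<circ> g" using 1 2 by (simp add: comp_assoc)
    ultimately show ?thesis using 1 2 p by (intro exI[of _ "(g2, A2)"]) auto
  qed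
  have "\<exists>f. \<forall>n. ok (f n) \<and> (snd (f n) \<subseteq> snd (f (Suc n)) \<and>
      (\<exists>h\<in>stab (snd (f n)). fst (f (Suc n)) = h \<circ> fst (f n)) \<and> n \<in> snd (f (Suc n)) \<and> fst (f (Suc n)) n \<in> snd (f (Suc n)))"
  proof (rule dependent_nat_choice)
    show "\<exists>p. ok p" using id_G by (intro exI[of _ "(id, {})"]) (simp add: ok_def agree_def)
  qed (rule step)
  then obtain f where f: "\<And>n. ok (f n)" "\<And>n. snd (f n) \<subseteq> snd (f (Suc n))"
    "\<And>n. \<exists>h\<in>stab (snd (f n)). fst (f (Suc n)) = h \<circ> fst (f n)"
    "\<And>n. n \<in> snd (f (Suc n))" "\<And>n. fst (f (Suc n)) n \<in> snd (f (Suc n))" by blast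
  define gs where "gs n = fst (f n)" for n
  define As where "As n = snd (f n)" for n
  have gsG: "gs n \<in> G" and ags: "agree (As n) y (act (gs n) x)" for n
    using f(1)[of n] by (auto simp: ok_def gs_def As_def split_beta)
  have later: "As n \<subseteq> As m \<and> (\<exists>h\<in>stab (As n). gs m = h \<circ> gs n)" if "n \<le> m" for n m
    using that
  proof (induction m rule: dec_induct)
    case base
    then show ?case by (auto intro!: bexI[OF _ id_stab])
  next
    case (step m)
    obtain h where h: "h \<in> stab (As n)" "gs m = h \<circ> gs n" using step by blast
    obtain k where k: "k \<in> stab (As m)" "gs (Suc m) = k \<circ> gs m" using f(3)[of m] by (auto simp: gs_def As_def)
    have "k \<in> stab (As n)" using k(1) step.IH by (auto simp: stab_def)
    then have "k \<circ> h \<in> stab (As n)" using h comp_stab by blast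
    moreover have "gs (Suc m) = (k \<circ> h) \<circ> gs n" using h k by (simp add: comp_assoc)
    ultimately show ?case using step.IH f(2)[of m] unfolding As_def by blast
  qed
  define G0 where "G0 n = gs (Suc n) n" for n
  have stable: "gs m n = G0 n" if le: "Suc n \<le> m" for m n
  proof -
    obtain h where h: "h \<in> stab (As (Suc n))" "gs m = h \<circ> gs (Suc n)" using later[OF le] by blast
    then show ?thesis using f(5)[of n] by (simp add: G0_def gs_def As_def stab_def)
  qed
  have stable_inv: "gs m n = b" if le: "Suc b \<le> m" and eq: "gs (Suc b) n = b" for m n b
  proof -
    obtain h where h: "h \<in> stab (As (Suc b))" "gs m = h \<circ> gs (Suc b)" using later[OF le] by blast
    then show ?thesis using f(4)[of b] eq by (simp add: As_def stab_def)
  qed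
  have inj: "inj G0"
  proof (rule injI)
    fix n n' assume "G0 n = G0 n'"
    then have "gs (Suc (max n n')) n = gs (Suc (max n n')) n'" using stable by simp
    then show "n = n'" using bij_G[OF gsG] bij_is_inj injD by metis
  qed
  have "\<exists>n. G0 n = b" for b
  proof -
    obtain n where n: "gs (Suc b) n = b" using inv_simps(2)[OF gsG] by metis
    then have "gs (Suc (max b n)) n = b" using stable_inv[of b "Suc (max b n)" n] by simp
    then show ?thesis using stable[of n "Suc (max b n)"] by auto
  qed
  then have "surj G0" by (metis surjI)
  then have bij: "bij G0" using inj by (simp add: bij_def)
  have approx: "\<exists>m. \<forall>a\<in>A. gs m a = G0 a" if A: "finite A" for A
  proof -
    obtain m where m: "\<forall>a\<in>A. a < m" using A finite_nat_set_iff_bounded by auto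
    have "gs m a = G0 a" if "a \<in> A" for a using stable[of a m] m that by auto
    then show ?thesis by blast
  qed
  have G0: "G0 \<in> G" using closed_G[OF bij] approx gsG by metis
  have "r (act G0 x) i j = r y i j" for i j
  proof -
    let ?i = "inv G0 i" and ?j = "inv G0 j"
    \<comment> \<open>A stage so late that the approximation is final at the preimages of
      \<open>i\<close> and \<open>j\<close>, and that \<open>i\<close> and \<open>j\<close> belong
      to the set of agreement.\<close>
    define m where "m = Suc (max (max i j) (max ?i ?j))"
    have gi: "gs m ?i = i" "gs m ?j = j" using stable[of ?i m] stable[of ?j m] inv_simps(2)[OF G0] by (auto simp: m_def)
    have "As (Suc i) \<subseteq> As m" "As (Suc j) \<subseteq> As m" using later[of "Suc i" m] later[of "Suc j" m] by (auto simp: m_def)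
    then have ij: "i \<in> As m" "j \<in> As m" using f(4)[of i] f(4)[of j] by (auto simp: As_def)
    have "r (act G0 x) i j = r x ?i ?j" using r_act'[OF G0 xX] .
    also have "\<dots> = r (act (gs m) x) i j" using r_act[OF gsG xX, of m ?i ?j] gi by simp
    also have "\<dots> = r y i j" using ags[of m] ij by (simp add: agree_def)
    finally show ?thesis .
  qed
  then have "r (act G0 x) = r y" by blast
  then have "act G0 x = y" using r_inj act_in[OF G0 xX] yX by blast
  then show ?thesis using G0 by blast
qed

section \<open>The generic points as a dense G-delta orbit of full measure\<close>

definition ext_set :: "nat set \<Rightarrow> nat \<Rightarrow> 'a set \<Rightarrow> 'a set" where
  "ext_set A b C = {x\<in>topspace X. \<forall>x0\<in>C. agree A x0 x \<longrightarrow> (\<exists>g\<in>stab A. agree (insert b A) x0 (act g x))}"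

lemma generic_eq:
  "generic = (\<Inter>(A, b)\<in>{A. finite A} \<times> UNIV. \<Inter>C\<in>cyls (insert b A). ext_set A b C)"
proof (intro set_eqI iffI)
  fix x assume "x \<in> generic"
  then show "x \<in> (\<Inter>(A, b)\<in>{A. finite A} \<times> UNIV. \<Inter>C\<in>cyls (insert b A). ext_set A b C)"
    unfolding generic_def ext_set_def by (auto simp: cyls_def cyl_def)
next
  fix x assume x: "x \<in> (\<Inter>(A, b)\<in>{A. finite A} \<times> UNIV. \<Inter>C\<in>cyls (insert b A). ext_set A b C)"
  have *: "x \<in> ext_set A b (cyl (insert b A) x0)" if "finite A" "x0 \<in> topspace X" for A b x0
    using x that by (auto simp: cyls_def)
  obtain x1 where "x1 \<in> topspace X" using nonempty by blast
  then have "x \<in> topspace X" using *[of "{}" x1] by (simp add: ext_set_def)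
  moreover have "\<exists>g\<in>stab A. agree (insert b A) x0 (act g x)"
    if "finite A" "x0 \<in> topspace X" "agree A x0 x" for A b x0
    using *[OF that(1,2), of b] that cyl_self[OF that(2)] by (auto simp: ext_set_def)
  ultimately show "x \<in> generic" by (simp add: generic_def)
qed

text \<open>The condition depends on \<open>x0\<close> only through its order on
  \<open>insert b A\<close>. Indexing by cylinders therefore leaves finitely many conditions for
  each \<open>A\<close> and \<open>b\<close>, countably many in all.\<close>

lemma ext_set_cyl:
  assumes A: "finite A" and x0: "x0 \<in> topspace X"
  shows "ext_set A b (cyl (insert b A) x0) =
    {x\<in>topspace X. agree A x0 x \<longrightarrow> (\<exists>g\<in>stab A. agree (insert b A) x0 (act g x))}"
proof -
  have "(agree A x1 x \<longrightarrow> (\<exists>g\<in>stab A. agree (insert b A) x1 (act g x))) \<longleftrightarrow>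
      (agree A x0 x \<longrightarrow> (\<exists>g\<in>stab A. agree (insert b A) x0 (act g x)))"
    if "x1 \<in> cyl (insert b A) x0" for x1 x
    using that agree_sym agree_trans agree_mono[of "insert b A" x0 x1 A] unfolding cyl_def by blast
  then show ?thesis using cyl_self[OF x0] unfolding ext_set_def by blast
qed

text \<open>Disagreement on \<open>A\<close> is decided by finitely many relations, and the
  existence of \<open>g\<close> is a union of open preimages.\<close>

lemma open_ext_set:
  assumes A: "finite A" and C: "C \<in> cyls (insert b A)"
  shows "openin X (ext_set A b C)"
proof -
  obtain x0 where x0: "x0 \<in> topspace X" "C = cyl (insert b A) x0" using C by (auto simp: cyls_def)
  have "ext_set A b C = {x\<in>topspace X. \<not> agree A x0 x} \<union>
      (\<Union>g\<in>stab A. {x\<in>topspace X. act g x \<in> cyl (insert b A) x0})"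
    unfolding x0(2) ext_set_cyl[OF A x0(1)] using act_in stab_G by (auto simp: cyl_def)
  moreover have "openin X {x\<in>topspace X. \<not> agree A x0 x}"
    by (rule open_if_finitary[OF A]) (auto simp: agree_def)
  moreover have "openin X (\<Union>g\<in>stab A. {x\<in>topspace X. act g x \<in> cyl (insert b A) x0})"
    using open_act_vimage open_cyl A stab_G by (intro openin_Union) auto
  ultimately show ?thesis by (simp add: openin_Un)
qed

lemma generic_index_countable:
  "countable (\<Union>(A, b)\<in>{A. finite A} \<times> UNIV. ext_set A b ` cyls (insert b A))"
proof (rule countable_UN)
  show "countable ({A :: nat set. finite A} \<times> (UNIV :: nat set))"
    using countable_Collect_finite by (intro countable_SIGMA) auto
  show "countable (case p of (A, b) \<Rightarrow> ext_set A b ` cyls (insert b A))"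
    if p: "p \<in> {A. finite A} \<times> UNIV" for p
  proof -
    have "finite (cyls (insert (snd p) (fst p)))" using p by (intro finite_cyls) auto
    then show ?thesis by (simp add: split_beta countable_finite)
  qed
qed

lemma generic_Inter:
  "generic = \<Inter>(\<Union>(A, b)\<in>{A. finite A} \<times> UNIV. ext_set A b ` cyls (insert b A))"
  unfolding generic_eq by auto

lemma gdelta_generic: "gdelta_in X generic"
  unfolding generic_Inter
proof (rule gdelta_in_Inter[OF generic_index_countable])
  have "cyls (insert 0 {}) \<noteq> {}" using nonempty by (auto simp: cyls_def)
  then show "(\<Union>(A, b)\<in>{A. finite A} \<times> UNIV. ext_set A b ` cyls (insert b A)) \<noteq> {}" by blast
qed (auto intro!: open_imp_gdelta_in open_ext_set)

lemma generic_AE: "AE x in \<mu>. x \<in> generic"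
proof -
  have "AE x in \<mu>. \<forall>T\<in>(\<Union>(A, b)\<in>{A. finite A} \<times> UNIV. ext_set A b ` cyls (insert b A)). x \<in> T"
  proof (subst AE_ball_countable[OF generic_index_countable], rule ballI)
    fix T assume "T \<in> (\<Union>(A, b)\<in>{A. finite A} \<times> UNIV. ext_set A b ` cyls (insert b A))"
    then obtain A b x0 where A: "finite A" and x0: "x0 \<in> topspace X" and T: "T = ext_set A b (cyl (insert b A) x0)"
      by (auto simp: cyls_def)
    show "AE x in \<mu>. x \<in> T"
      unfolding T ext_set_cyl[OF A x0] using extension_AE[OF A x0, of b] AE_space
      by eventually_elim (simp add: space_mu)
  qed
  then show ?thesis unfolding generic_Inter by eventually_elim blast
qed

lemma generic_measurable: "generic \<in> sets \<mu>"
proof -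
  obtain \<U> where "countable \<U>" "\<U> \<subseteq> {U. openin X U}" "\<Inter>\<U> = generic" "generic \<subseteq> topspace X"
    using gdelta_generic by (auto simp: gdelta_in_alt intersection_of_def)
  then have "generic = (\<Inter>U\<in>insert (topspace X) \<U>. U)" by auto
  also have "\<dots> \<in> sets \<mu>"
    using \<open>countable \<U>\<close> \<open>\<U> \<subseteq> {U. openin X U}\<close> open_measurable
    by (intro sets.countable_INT') auto
  finally show ?thesis .
qed

lemma emeasure_generic: "emeasure \<mu> generic = 1"
  using prob_eq_1[OF generic_measurable] generic_AE by (simp add: emeasure_eq_measure)

lemma generic_nonempty: "generic \<noteq> {}"
  using emeasure_generic by auto

lemma generic_orbit: assumes "x \<in> generic" shows "flow_orbit G act x = generic"
  using assms generic_single_orbit generic_act unfolding flow_orbit_def by blast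

text \<open>In a minimal flow every orbit meets every nonempty open set, so density of the generic
  orbit needs no measure.\<close>

lemma dense_orbit:
  assumes x: "x \<in> topspace X" shows "X closure_of flow_orbit G act x = topspace X"
proof -
  have "flow_orbit G act x \<inter> U \<noteq> {}" if "openin X U" "U \<noteq> {}" for U
    using orbit_meets_open[OF that x] by (auto simp: flow_orbit_def)
  then show ?thesis unfolding dense_intersects_open by blast
qed

lemma dense_gdelta_orbit_generic: "dense_gdelta_orbit G X act generic"
proof -
  obtain x where x: "x \<in> generic" using generic_nonempty by blast
  then have "x \<in> topspace X" by (simp add: generic_def)
  then show ?thesis
    using generic_orbit[OF x] dense_orbit[of x] gdelta_generic unfolding dense_gdelta_orbit_def by metis
qed

text \<open>Baire category in a compact Hausdorff space, for both families of open sets at once: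
  each member contains a dense set.\<close>

lemma dense_gdelta_meet:
  assumes S: "gdelta_in X S" "X closure_of S = topspace X" and T: "gdelta_in X T" "X closure_of T = topspace X"
  shows "S \<inter> T \<noteq> {}"
proof -
  have cH: "compact_space X" "Hausdorff_space X" using flow by (auto simp: G_flow_def)
  obtain \<U> where U: "countable \<U>" "\<U> \<subseteq> {U. openin X U}" "\<Inter>\<U> = S"
    using S(1) by (auto simp: gdelta_in_alt intersection_of_def)
  obtain \<V> where V: "countable \<V>" "\<V> \<subseteq> {U. openin X U}" "\<Inter>\<V> = T"
    using T(1) by (auto simp: gdelta_in_alt intersection_of_def)
  have "X closure_of \<Inter>(\<U> \<union> \<V>) = topspace X"
  proof (rule Baire_category)
    show "completely_metrizable_space X \<or> locally_compact_space X \<and> regular_space X"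
      using cH by (simp add: compact_imp_locally_compact_space compact_Hausdorff_imp_regular_space)
    show "countable (\<U> \<union> \<V>)" using U V by simp
    fix W assume W: "W \<in> \<U> \<union> \<V>"
    then have "S \<subseteq> W \<or> T \<subseteq> W" using U(3) V(3) by blast
    then have "topspace X \<subseteq> X closure_of W" using S(2) T(2) closure_of_mono by metis
    then show "openin X W \<and> X closure_of W = topspace X"
      using W U(2) V(2) closure_of_subset_topspace[of X W] by blast
  qed
  then have "\<Inter>(\<U> \<union> \<V>) \<noteq> {}" using nonempty by (metis closure_of_empty)
  then show ?thesis using U(3) V(3) by (simp add: Inf_union_distrib)
qed

text \<open>The orbit meets \<open>generic\<close>, and \<open>generic\<close> is invariant and a
  single orbit.\<close>

lemma dense_gdelta_orbit_unique:
  assumes "dense_gdelta_orbit G X act Orb" shows "Orb = generic"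
proof -
  obtain x where x: "x \<in> topspace X" "Orb = flow_orbit G act x"
    and "X closure_of Orb = topspace X" "gdelta_in X Orb"
    using assms by (auto simp: dense_gdelta_orbit_def)
  then have "Orb \<inter> generic \<noteq> {}"
    using dense_gdelta_meet[of Orb generic] dense_gdelta_orbit_generic
    by (simp add: dense_gdelta_orbit_def)
  then obtain g where g: "g \<in> G" "act g x \<in> generic" using x(2) by (auto simp: flow_orbit_def)
  then have "act (inv g) (act g x) \<in> generic" using generic_act inv_G by blast
  then have "x \<in> generic" using act_inv(1)[OF g(1) x(1)] by simp
  then show ?thesis using generic_orbit x(2) by simp
qed

end

theorem mainTheorem3:
  fixes ar :: "'l::countable \<Rightarrow> nat"
    and K :: "('l, nat) struc set"
    and R :: "'l \<Rightarrow> nat list \<Rightarrow> bool"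
    and X :: "'x topology"
    and act :: "(nat \<Rightarrow> nat) \<Rightarrow> 'x \<Rightarrow> 'x"
  assumes "fraisse_class ar K"
    and "ramsey_class K"
    and "is_fraisse_limit ar K R"
    and "universal_minimal_flow (Aut (UNIV, R)) X act"
    and amenable: "\<exists>\<mu>. invariant_borel_prob (Aut (UNIV, R)) X act \<mu>"
  shows "(\<exists>!\<mu>. invariant_borel_prob (Aut (UNIV, R)) X act \<mu>) \<and>
    (\<forall>\<mu>. invariant_borel_prob (Aut (UNIV, R)) X act \<mu> \<longrightarrow>
      (\<exists>Orb. dense_gdelta_orbit (Aut (UNIV, R)) X act Orb \<and> emeasure \<mu> Orb = 1 \<and>
           (\<forall>Orb'. dense_gdelta_orbit (Aut (UNIV, R)) X act Orb' \<longrightarrow> Orb' = Orb)))"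
proof -
  let ?G = "Aut (UNIV, R)"
  have G: "ramsey_group ?G" using ramsey_group_Aut[OF assms(2,3)] .
  have "minimal_flow ?G X act" using assms(4) by (simp add: universal_minimal_flow_def)
  then have flow: "ramsey_flow ?G X act"
    using G by (simp add: ramsey_flow_def ramsey_flow_axioms_def)
  obtain r where r: "\<forall>x\<in>topspace X. strict_linear (\<lambda>(i, j). r x i j)"
    "\<forall>i j. openin X {x\<in>topspace X. r x i j}"
    "\<forall>g\<in>?G. \<forall>x\<in>topspace X. \<forall>i j. r (act g x) (g i) (g j) = r x i j"
    using universal_minimal_flow_order[OF G assms(4)] by (elim exE conjE)
  have "ordered_flow ?G X act r"
    by (intro ordered_flow.intro ordered_flow_axioms.intro flow) (use r in blast)+
  then interpret ordered_flow ?G X act r .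
  have "\<exists>!\<mu>. invariant_borel_prob ?G X act \<mu>"
    using amenable invariant_borel_prob_unique by blast
  moreover have "\<exists>Orb. dense_gdelta_orbit ?G X act Orb \<and> emeasure \<mu> Orb = 1 \<and>
      (\<forall>Orb'. dense_gdelta_orbit ?G X act Orb' \<longrightarrow> Orb' = Orb)"
    if "invariant_borel_prob ?G X act \<mu>" for \<mu>
  proof -
    interpret measured_flow ?G X act r \<mu> by unfold_locales fact
    show ?thesis
      using dense_gdelta_orbit_generic emeasure_generic dense_gdelta_orbit_unique by blast
  qed
  ultimately show ?thesis by blast
qed

end
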